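(* For every $n \geq 1$, the coproduct of $\delta_n$ in $\mathcal{H}^1_{\mathrm{CM}}$ is $$\Delta(\delta_n) = \delta_n \otimes 1 + 1 \otimes \delta_n + \sum_{\substack{(n_1,\ldots,n_{s+1}) \in \mathcal{N}_n \\ s \geq 1}} \frac{n!}{n_1! \cdots n_{s+1}!}\, \alpha^{n_1,\ldots,n_s}_{n_{s+1}}\, \delta_{n_1} \cdots \delta_{n_s} \otimes \delta_{n_{s+1}},$$ where, for $\boldsymbol{n} = (n_1,\ldots,n_s) \in \mathcal{N}$ (so $l(\boldsymbol{n}) = s$) and $m \geq 1$, $$\alpha^{\boldsymbol{n}}_m = \sum_{t=1}^{l(\boldsymbol{n})} \binom{m}{t} \sum_{\boldsymbol{n}^1 \cdots \boldsymbol{n}^t = \boldsymbol{n}} A(\boldsymbol{n}^1,\ldots,\boldsymbol{n}^t),$$ with the convention $\binom{m}{t} = \frac{m!}{t!(m-t)!} = 0$ if $t > m$.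
   Context: The Connes-Moscovici Hopf algebra $\mathcal{H}_{\mathrm{CM}}$ is, as an algebra, the enveloping algebra of the (real) Lie algebra with linear basis $Y$, $X$, $\delta_n$ ($n \geq 1$) and relations $[Y,X] = X$, $[Y,\delta_n] = n\delta_n$, $[\delta_n,\delta_m] = 0$, $[X,\delta_n] = \delta_{n+1}$ for all $m,n \geq 1$. Its coproduct $\Delta$ is the algebra morphism ($\Delta(h_1h_2) = \Delta(h_1)\Delta(h_2)$) determined by $\Delta(Y) = Y \otimes 1 + 1 \otimes Y$, $\Delta(X) = X \otimes 1 + 1 \otimes X + \delta_1 \otimes Y$, $\Delta(\delta_1) = \delta_1 \otimes 1 + 1 \otimes \delta_1$; the coproducts $\Delta(\delta_n)$ are then determined recursively by $\delta_{n+1} = [X,\delta_n]$. The subalgebra $\mathcal{H}^1_{\mathrm{CM}} \subset \mathcal{H}_{\mathrm{CM}}$ generated by $\{\delta_n : n \geq 1\}$ is a sub-Hopf algebra, graded by $\mathrm{gr}(\delta_{n_1} \cdots \delta_{n_s}) = n_1 + \cdots + n_s$. Notation. $\mathbb{N}^* = \{1,2,\ldots\}$, and $\mathcal{N} = \{\boldsymbol{n} = (n_1,\ldots,n_s) \in (\mathbb{N}^* )^s : s \geq 1\}$ is the set of nonempty finite sequences of positive integers. For $\boldsymbol{n} = (n_1,\ldots,n_s) \in \mathcal{N}$: $\|\boldsymbol{n}\| = n_1 + \cdots + n_s$ and $l(\boldsymbol{n}) = s$. For $n \geq 1$, $\mathcal{N}_n = \{\boldsymbol{n} \in \mathcal{N}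 : \|\boldsymbol{n}\| = n\}$. The sum $\sum_{\boldsymbol{n}^1 \cdots \boldsymbol{n}^t = \boldsymbol{n}}$ (with $t$ fixed) is over all $t$-tuples $(\boldsymbol{n}^1,\ldots,\boldsymbol{n}^t) \in \mathcal{N}^t$ of nonempty sequences whose concatenation is $\boldsymbol{n}$. For $(\boldsymbol{n}^1,\ldots,\boldsymbol{n}^t) \in \mathcal{N}^t$, $$A(\boldsymbol{n}^1,\ldots,\boldsymbol{n}^t) = \frac{1}{l(\boldsymbol{n}^1)! \cdots l(\boldsymbol{n}^t)!} \prod_{i=1}^t \frac{1}{\|\boldsymbol{n}^i\| + 1}.$$ *)

theory Defs
  imports Complex_Main "HOL-Library.Poly_Mapping"
begin

section \<open>Finitely supported functions as free real vector spaces and monoid algebras\<close>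

instantiation poly_mapping :: (type, real_vector) real_vector
begin

lift_definition scaleR_poly_mapping :: "real \<Rightarrow> ('a \<Rightarrow>\<^sub>0 'b) \<Rightarrow> 'a \<Rightarrow>\<^sub>0 'b"
  is "\<lambda>r f k. r *\<^sub>R f k"
  by (rule finite_subset[rotated], assumption) auto

instance
  by standard (transfer; auto simp: fun_eq_iff algebra_simps)+

end

lemma lookup_scaleR [simp]: "Poly_Mapping.lookup (r *\<^sub>R p) k = r *\<^sub>R Poly_Mapping.lookup p k"
  by transfer simp

lemma scaleR_single: "r *\<^sub>R Poly_Mapping.single a b = Poly_Mapping.single a (r *\<^sub>R b)"
  by (rule poly_mapping_eqI) (simp add: lookup_single when_def)

definition lin_ext :: "('a \<Rightarrow> 'b::real_vector) \<Rightarrow> ('a \<Rightarrow>\<^sub>0 real) \<Rightarrow> 'b" where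
  "lin_ext f p = (\<Sum>a\<in>Poly_Mapping.keys p. Poly_Mapping.lookup p a *\<^sub>R f a)"

lemma lin_ext_superset:
  assumes "finite A" "Poly_Mapping.keys p \<subseteq> A"
  shows "lin_ext f p = (\<Sum>a\<in>A. Poly_Mapping.lookup p a *\<^sub>R f a)"
  unfolding lin_ext_def
  by (rule sum.mono_neutral_left) (use assms in \<open>auto simp: in_keys_iff\<close>)

lemma linear_lin_ext: "linear (lin_ext f)"
proof (rule linearI)
  fix p q :: "'a \<Rightarrow>\<^sub>0 real" and r :: real
  let ?K = "Poly_Mapping.keys p \<union> Poly_Mapping.keys q"
  have "lin_ext f (p + q) = (\<Sum>a\<in>?K. Poly_Mapping.lookup (p + q) a *\<^sub>R f a)"
    by (rule lin_ext_superset) (simp_all add: keys_add)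
  moreover have "lin_ext f p = (\<Sum>a\<in>?K. Poly_Mapping.lookup p a *\<^sub>R f a)"
    by (rule lin_ext_superset) simp_all
  moreover have "lin_ext f q = (\<Sum>a\<in>?K. Poly_Mapping.lookup q a *\<^sub>R f a)"
    by (rule lin_ext_superset) simp_all
  ultimately show "lin_ext f (p + q) = lin_ext f p + lin_ext f q"
    by (simp add: lookup_add scaleR_add_left sum.distrib)
  have "lin_ext f (r *\<^sub>R p) = (\<Sum>a\<in>Poly_Mapping.keys p. Poly_Mapping.lookup (r *\<^sub>R p) a *\<^sub>R f a)"
    by (rule lin_ext_superset) (auto simp: in_keys_iff)
  then show "lin_ext f (r *\<^sub>R p) = r *\<^sub>R lin_ext f p"
    by (simp add: lin_ext_def scaleR_sum_right)
qed

lemma lin_ext_single [simp]: "lin_ext f (Poly_Mapping.single a r) = r *\<^sub>R f a"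
  by (simp add: lin_ext_def)

lemma poly_mapping_expand:
  "p = (\<Sum>a\<in>Poly_Mapping.keys p. Poly_Mapping.lookup p a *\<^sub>R Poly_Mapping.single a (1::real))"
proof (rule poly_mapping_eqI)
  fix k
  show "Poly_Mapping.lookup p k
      = Poly_Mapping.lookup (\<Sum>a\<in>Poly_Mapping.keys p. Poly_Mapping.lookup p a *\<^sub>R Poly_Mapping.single a (1::real)) k"
    by (auto simp: lookup_sum lookup_single when_def in_keys_iff if_distrib cong: if_cong)
qed

lemma linear_eq_on_singles:
  fixes F G :: "('a \<Rightarrow>\<^sub>0 real) \<Rightarrow> 'b::real_vector"
  assumes F: "linear F" and G: "linear G"
    and eq: "\<And>a. F (Poly_Mapping.single a 1) = G (Poly_Mapping.single a 1)"
  shows "F p = G p"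
proof -
  have "F p = (\<Sum>a\<in>Poly_Mapping.keys p. Poly_Mapping.lookup p a *\<^sub>R F (Poly_Mapping.single a 1))"
    by (subst poly_mapping_expand[of p]) (simp add: linear_sum[OF F] linear_cmul[OF F])
  also have "\<dots> = (\<Sum>a\<in>Poly_Mapping.keys p. Poly_Mapping.lookup p a *\<^sub>R G (Poly_Mapping.single a 1))"
    by (simp add: eq)
  also have "\<dots> = G p"
    by (subst (2) poly_mapping_expand[of p]) (simp add: linear_sum[OF G] linear_cmul[OF G])
  finally show ?thesis .
qed

instance poly_mapping :: (monoid_add, real_algebra_1) real_algebra_1
proof
  fix r :: real and x y :: "'a \<Rightarrow>\<^sub>0 'b"
  have 1: "s *\<^sub>R z = Poly_Mapping.single 0 (of_real s) * z" for s and z :: "'a \<Rightarrow>\<^sub>0 'b"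
    unfolding mult_map_scale_conv_mult[symmetric]
    by (rule poly_mapping_eqI)
      (simp add: Poly_Mapping.map.rep_eq when_def scaleR_conv_of_real)
  show "r *\<^sub>R x * y = r *\<^sub>R (x * y)"
    by (simp add: 1 mult.assoc)
  have 2: "z * Poly_Mapping.single 0 (of_real r) = Poly_Mapping.single 0 (of_real r) * z"
    for z :: "'a \<Rightarrow>\<^sub>0 'b"
  proof (induction z rule: update_induct)
    case const
    then show ?case by simp
  next
    case (update f a b)
    have "Poly_Mapping.update a b f = f + Poly_Mapping.single a b"
      by (rule poly_mapping_eqI)
        (use update(1) in \<open>auto simp: lookup_update lookup_add lookup_single when_def in_keys_iff\<close>)
    then show ?case
      using update by (simp add: algebra_simps mult_single of_real_def)
  qed
  show "x * r *\<^sub>R y = r *\<^sub>R (x * y)"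
    by (metis 1 2 mult.assoc)
qed

definition alg_hom :: "('a::real_algebra_1 \<Rightarrow> 'b::real_algebra_1) \<Rightarrow> bool" where
  "alg_hom f \<longleftrightarrow> linear f \<and> f 1 = 1 \<and> (\<forall>x y. f (x * y) = f x * f y)"

lemma alg_homD:
  assumes "alg_hom f"
  shows "linear f" "f 1 = 1" "f (x * y) = f x * f y"
    "f (x + y) = f x + f y" "f (x - y) = f x - f y" "f (r *\<^sub>R x) = r *\<^sub>R f x" "f 0 = 0"
  using assms unfolding alg_hom_def
  by (auto simp: linear_add linear_diff linear_cmul linear_0)

lemma alg_hom_lin_ext:
  fixes h :: "'m::monoid_add \<Rightarrow> 'a::real_algebra_1"
  assumes "h 0 = 1" and "\<And>a b. h (a + b) = h a * h b"
  shows "alg_hom (lin_ext h)"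
  unfolding alg_hom_def
proof (intro conjI allI)
  show lin: "linear (lin_ext h)" by (rule linear_lin_ext)
  show "lin_ext h 1 = 1"
    by (simp add: assms flip: single_one)
  fix x y :: "'m \<Rightarrow>\<^sub>0 real"
  have "lin_ext h (Poly_Mapping.single a 1 * y) = h a * lin_ext h y" for a
  proof (rule linear_eq_on_singles[where p = y and F = "\<lambda>y. lin_ext h (Poly_Mapping.single a 1 * y)"
        and G = "\<lambda>y. h a * lin_ext h y"])
    show "linear (\<lambda>y. lin_ext h (Poly_Mapping.single a 1 * y))"
      "linear (\<lambda>y. h a * lin_ext h y)"
      by (rule linearI; simp add: distrib_left linear_add[OF lin] linear_cmul[OF lin])+
  qed (simp add: mult_single assms)
  then have single: "lin_ext h (Poly_Mapping.single a 1 * y)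
      = lin_ext h (Poly_Mapping.single a 1) * lin_ext h y" for a
    by simp
  show "lin_ext h (x * y) = lin_ext h x * lin_ext h y"
  proof (rule linear_eq_on_singles[where p = x and F = "\<lambda>x. lin_ext h (x * y)"
        and G = "\<lambda>x. lin_ext h x * lin_ext h y"])
    show "linear (\<lambda>x. lin_ext h (x * y))" "linear (\<lambda>x. lin_ext h x * lin_ext h y)"
      by (rule linearI; simp add: distrib_right linear_add[OF lin] linear_cmul[OF lin])+
  qed (rule single)
qed


section \<open>Lie algebras and their enveloping algebras\<close>

class lie_algebra = real_vector +
  fixes lie :: "'a \<Rightarrow> 'a \<Rightarrow> 'a"
  assumes lie_add_left: "lie (x + y) z = lie x z + lie y z"
    and lie_add_right: "lie x (y + z) = lie x y + lie x z"
    and lie_scaleR_left: "lie (scaleR r x) y = scaleR r (lie x y)"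
    and lie_scaleR_right: "lie x (scaleR r y) = scaleR r (lie x y)"
    and lie_self: "lie x x = 0"
    and lie_jacobi: "lie x (lie y z) + lie y (lie z x) + lie z (lie x y) = 0"

text \<open>Words, with concatenation written additively, so that finitely supported functions
  on words carry the convolution product of the free algebra.\<close>

datatype 'g lword = Word (letters: "'g list")

instantiation lword :: (type) monoid_add
begin
definition zero_lword :: "'a lword" where "0 = Word []"
definition plus_lword :: "'a lword \<Rightarrow> 'a lword \<Rightarrow> 'a lword" where
  "u + v = Word (letters u @ letters v)"
instance
  by standard (simp_all add: zero_lword_def plus_lword_def)
end

type_synonym 'g free_algebra = "'g lword \<Rightarrow>\<^sub>0 real"

definition fgen :: "'g \<Rightarrow> 'g free_algebra" where
  "fgen x = Poly_Mapping.single (Word [x]) 1"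

text \<open>The free algebra is taken on all elements of the Lie algebra, so the first two
  families of relations cut it down to the tensor algebra.\<close>

inductive_set uenv_ideal :: "'g::lie_algebra free_algebra set" where
  rel_add: "fgen (x + y) - fgen x - fgen y \<in> uenv_ideal"
| rel_scaleR: "fgen (r *\<^sub>R x) - r *\<^sub>R fgen x \<in> uenv_ideal"
| rel_lie: "fgen x * fgen y - fgen y * fgen x - fgen (lie x y) \<in> uenv_ideal"
| zero: "0 \<in> uenv_ideal"
| add: "u \<in> uenv_ideal \<Longrightarrow> v \<in> uenv_ideal \<Longrightarrow> u + v \<in> uenv_ideal"
| mult_left: "u \<in> uenv_ideal \<Longrightarrow> a * u \<in> uenv_ideal"
| mult_right: "u \<in> uenv_ideal \<Longrightarrow> u * a \<in> uenv_ideal"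

lemma uenv_ideal_scaleR:
  assumes "u \<in> uenv_ideal"
  shows "r *\<^sub>R u \<in> uenv_ideal"
  using uenv_ideal.mult_left[OF assms, of "r *\<^sub>R 1"] by simp

lemma uenv_ideal_uminus:
  assumes "u \<in> uenv_ideal"
  shows "- u \<in> uenv_ideal"
  using uenv_ideal_scaleR[OF assms, of "-1"] by simp

lemma uenv_ideal_diff:
  assumes "u \<in> uenv_ideal" and "v \<in> uenv_ideal"
  shows "u - v \<in> uenv_ideal"
  using uenv_ideal.add[OF assms(1) uenv_ideal_uminus[OF assms(2)]] by simp

lemma uenv_ideal_eqI: "u = v \<Longrightarrow> u - v \<in> uenv_ideal"
  by (simp add: uenv_ideal.zero)

quotient_type (overloaded) 'g uenv = "'g::lie_algebra free_algebra" / "\<lambda>u v. u - v \<in> uenv_ideal"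
proof (rule equivpI)
  show "reflp (\<lambda>u v::'g free_algebra. u - v \<in> uenv_ideal)"
    by (rule reflpI) (simp add: uenv_ideal.zero)
  show "symp (\<lambda>u v::'g free_algebra. u - v \<in> uenv_ideal)"
    by (rule sympI) (drule uenv_ideal_uminus, simp)
  show "transp (\<lambda>u v::'g free_algebra. u - v \<in> uenv_ideal)"
    by (rule transpI) (drule (1) uenv_ideal.add, simp)
qed

definition word_eval :: "('g \<Rightarrow> 'a::real_algebra_1) \<Rightarrow> 'g free_algebra \<Rightarrow> 'a" where
  "word_eval f = lin_ext (\<lambda>w. prod_list (map f (letters w)))"

lemma alg_hom_word_eval: "alg_hom (word_eval f)"
  unfolding word_eval_def
  by (rule alg_hom_lin_ext) (simp_all add: zero_lword_def plus_lword_def)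

lemma word_eval_fgen [simp]: "word_eval f (fgen x) = f x"
  by (simp add: word_eval_def fgen_def)

lemma word_eval_ideal:
  assumes "linear f" and "\<And>x y. f (lie x y) = f x * f y - f y * f x" and "u \<in> uenv_ideal"
  shows "word_eval f u = 0"
  using assms(3)
  by induction
    (simp_all add: alg_homD[OF alg_hom_word_eval] linear_add[OF assms(1)]
      linear_cmul[OF assms(1)] assms(2))

lemma one_notin_uenv_ideal: "(1 :: 'g::lie_algebra free_algebra) \<notin> uenv_ideal"
proof
  assume "(1 :: 'g free_algebra) \<in> uenv_ideal"
  then have "word_eval (\<lambda>_::'g. 0::real) 1 = 0"
    by (intro word_eval_ideal) (auto intro: linearI)
  then show False
    using alg_homD(2)[OF alg_hom_word_eval] by (metis zero_neq_one)
qed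

instantiation uenv :: (lie_algebra) real_algebra_1
begin

lift_definition zero_uenv :: "'a uenv" is 0 .
lift_definition one_uenv :: "'a uenv" is 1 .
lift_definition plus_uenv :: "'a uenv \<Rightarrow> 'a uenv \<Rightarrow> 'a uenv" is "(+)"
  by (drule (1) uenv_ideal.add) (simp add: algebra_simps)
lift_definition minus_uenv :: "'a uenv \<Rightarrow> 'a uenv \<Rightarrow> 'a uenv" is "(-)"
  by (drule (1) uenv_ideal_diff) (simp add: algebra_simps)
lift_definition uminus_uenv :: "'a uenv \<Rightarrow> 'a uenv" is uminus
  by (drule uenv_ideal_uminus) simp
lift_definition scaleR_uenv :: "real \<Rightarrow> 'a uenv \<Rightarrow> 'a uenv" is scaleR
  by (drule uenv_ideal_scaleR) (simp add: scaleR_diff_right)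
lift_definition times_uenv :: "'a uenv \<Rightarrow> 'a uenv \<Rightarrow> 'a uenv" is "(*)"
proof -
  fix u u' v v' :: "'a free_algebra"
  assume "u - u' \<in> uenv_ideal" "v - v' \<in> uenv_ideal"
  then have "(u - u') * v + u' * (v - v') \<in> uenv_ideal"
    by (intro uenv_ideal.add[OF uenv_ideal.mult_right uenv_ideal.mult_left])
  then show "u * v - u' * v' \<in> uenv_ideal"
    by (simp add: algebra_simps)
qed

instance
proof
  show "(0 :: 'a uenv) \<noteq> 1"
    by transfer (auto dest: uenv_ideal_uminus simp: one_notin_uenv_ideal)
qed (transfer, rule uenv_ideal_eqI, simp add: algebra_simps)+

end

lift_definition uinc :: "'g::lie_algebra \<Rightarrow> 'g uenv" is fgen .

lemma linear_uinc: "linear uinc"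
  by (rule linearI; transfer)
    (use uenv_ideal.rel_add uenv_ideal.rel_scaleR in \<open>auto simp: diff_diff_add\<close>)

lemma uinc_lie: "uinc (lie x y) = uinc x * uinc y - uinc y * uinc x"
proof -
  have "uinc x * uinc y - uinc y * uinc x = uinc (lie x y)"
    by transfer (rule uenv_ideal.rel_lie)
  then show ?thesis ..
qed

abbreviation ucls :: "'g::lie_algebra free_algebra \<Rightarrow> 'g uenv" where
  "ucls \<equiv> abs_uenv"

lemma ucls_eq_iff: "ucls u = ucls v \<longleftrightarrow> u - v \<in> uenv_ideal"
  by (rule uenv.abs_eq_iff)

lemma alg_hom_ucls: "alg_hom ucls"
  unfolding alg_hom_def
  by (intro conjI allI linearI)
    (simp_all add: plus_uenv.abs_eq scaleR_uenv.abs_eq times_uenv.abs_eq one_uenv.abs_eq)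

lemma ucls_fgen: "ucls (fgen x) = uinc x"
  by (simp add: uinc.abs_eq)

lemma ucls_surj: "\<exists>u. ucls u = v"
  by (metis Quotient_abs_rep Quotient_uenv)

lemma alg_hom_free_eq:
  assumes F: "alg_hom F" and G: "alg_hom G" and eq: "\<And>x. F (fgen x) = G (fgen x)"
  shows "F u = G u"
proof (rule linear_eq_on_singles[OF alg_homD(1)[OF F] alg_homD(1)[OF G]])
  fix w :: "'a lword"
  obtain xs where w: "w = Word xs" by (cases w)
  have "F (Poly_Mapping.single (Word xs) 1) = G (Poly_Mapping.single (Word xs) 1)"
  proof (induction xs)
    case Nil
    have "Poly_Mapping.single (Word []) 1 = (1 :: 'a free_algebra)"
      by (simp flip: zero_lword_def)
    then show ?case by (simp add: alg_homD(2)[OF F] alg_homD(2)[OF G])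
  next
    case (Cons x xs)
    have "Poly_Mapping.single (Word (x # xs)) 1
        = fgen x * (Poly_Mapping.single (Word xs) 1 :: 'a free_algebra)"
      by (simp add: fgen_def mult_single plus_lword_def)
    then show ?case by (simp add: alg_homD(3)[OF F] alg_homD(3)[OF G] eq Cons)
  qed
  then show "F (Poly_Mapping.single w 1) = G (Poly_Mapping.single w 1)"
    by (simp add: w)
qed

lemma alg_hom_comp: "alg_hom F \<Longrightarrow> alg_hom G \<Longrightarrow> alg_hom (\<lambda>u. F (G u))"
  unfolding alg_hom_def using linear_compose[of G F] by (auto simp: o_def)

lemma alg_hom_uenv_eq:
  fixes F G :: "'g::lie_algebra uenv \<Rightarrow> 'a::real_algebra_1"
  assumes "alg_hom F" and "alg_hom G" and "\<And>x. F (uinc x) = G (uinc x)"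
  shows "F = G"
proof
  fix v :: "'g uenv"
  obtain u where "v = ucls u" using ucls_surj by metis
  moreover have "F (ucls u) = G (ucls u)"
    by (rule alg_hom_free_eq[where F = "\<lambda>u. F (ucls u)" and G = "\<lambda>u. G (ucls u)"])
      (simp_all add: assms alg_hom_comp alg_hom_ucls ucls_fgen)
  ultimately show "F v = G v" by simp
qed

theorem uenv_universal:
  fixes f :: "'g::lie_algebra \<Rightarrow> 'a::real_algebra_1"
  assumes lin: "linear f" and lie: "\<And>x y. f (lie x y) = f x * f y - f y * f x"
  shows "\<exists>!F. alg_hom F \<and> (\<forall>x. F (uinc x) = f x)"
proof (rule ex_ex1I)
  define F where "F v = word_eval f (SOME u. ucls u = v)" for v
  have F: "F (ucls u) = word_eval f u" for u
  proof -
    have "ucls (SOME u'. ucls u' = ucls u) = ucls u"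
      by (rule someI) simp
    then have "(SOME u'. ucls u' = ucls u) - u \<in> uenv_ideal"
      by (simp add: ucls_eq_iff)
    from word_eval_ideal[OF lin lie this] show ?thesis
      by (simp add: F_def alg_homD(5)[OF alg_hom_word_eval])
  qed
  have "alg_hom F"
    unfolding alg_hom_def
  proof (intro conjI allI linearI)
    show "F 1 = 1"
      using F[of 1] by (simp add: alg_homD(2)[OF alg_hom_ucls] alg_homD(2)[OF alg_hom_word_eval])
    fix x y :: "'g uenv" and r
    obtain u v where "x = ucls u" "y = ucls v" using ucls_surj by metis
    then show "F (x * y) = F x * F y" "F (x + y) = F x + F y" "F (r *\<^sub>R x) = r *\<^sub>R F x"
      by (simp_all add: F alg_homD[OF alg_hom_word_eval] flip: alg_homD[OF alg_hom_ucls])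
  qed
  moreover have "F (uinc x) = f x" for x
    by (simp add: F flip: ucls_fgen)
  ultimately show "\<exists>F. alg_hom F \<and> (\<forall>x. F (uinc x) = f x)" by blast
qed (auto intro: alg_hom_uenv_eq)


section \<open>Tensor products of algebras\<close>

text \<open>Pairs with the componentwise product, again written additively: the monoid algebra on
  these pairs is the free vector space on them with the product of pairs extended bilinearly.\<close>

datatype ('a, 'b) tpair = TPair 'a 'b

instantiation tpair :: (monoid_mult, monoid_mult) monoid_add
begin
definition zero_tpair :: "('a, 'b) tpair" where "0 = TPair 1 1"
fun plus_tpair :: "('a, 'b) tpair \<Rightarrow> ('a, 'b) tpair \<Rightarrow> ('a, 'b) tpair" where
  "TPair a b + TPair c d = TPair (a * c) (b * d)"
instance
proof
  fix x y z :: "('a, 'b) tpair"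
  show "x + y + z = x + (y + z)"
    by (cases x; cases y; cases z) (simp add: mult.assoc)
  show "0 + x = x" "x + 0 = x"
    by (cases x; simp add: zero_tpair_def)+
qed
end

definition ptens :: "'a::real_algebra_1 \<Rightarrow> 'b::real_algebra_1 \<Rightarrow> ('a, 'b) tpair \<Rightarrow>\<^sub>0 real" where
  "ptens a b = Poly_Mapping.single (TPair a b) 1"

lemma ptens_mult: "ptens a b * ptens c d = ptens (a * c) (b * d)"
  by (simp add: ptens_def mult_single)

inductive_set tensor_rels ::
  "(('a::real_algebra_1, 'b::real_algebra_1) tpair \<Rightarrow>\<^sub>0 real) set" where
  "ptens (a + a') b - ptens a b - ptens a' b \<in> tensor_rels"
| "ptens a (b + b') - ptens a b - ptens a b' \<in> tensor_rels"
| "ptens (r *\<^sub>R a) b - r *\<^sub>R ptens a b \<in> tensor_rels"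
| "ptens a (r *\<^sub>R b) - r *\<^sub>R ptens a b \<in> tensor_rels"

definition tensor_null :: "(('a::real_algebra_1, 'b::real_algebra_1) tpair \<Rightarrow>\<^sub>0 real) set" where
  "tensor_null = span tensor_rels"

lemma tensor_null_zero [simp]: "0 \<in> tensor_null"
  by (simp add: tensor_null_def span_zero)

lemma tensor_null_eqI: "u = v \<Longrightarrow> u - v \<in> tensor_null"
  by (simp add: tensor_null_def span_zero)

lemma tensor_null_ops:
  "u \<in> tensor_null \<Longrightarrow> v \<in> tensor_null \<Longrightarrow> u + v \<in> tensor_null"
  "u \<in> tensor_null \<Longrightarrow> v \<in> tensor_null \<Longrightarrow> u - v \<in> tensor_null"
  "u \<in> tensor_null \<Longrightarrow> - u \<in> tensor_null"
  "u \<in> tensor_null \<Longrightarrow> r *\<^sub>R u \<in> tensor_null"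
  by (auto simp: tensor_null_def intro: span_add span_diff span_neg span_scale)

lemma ptens_induct:
  fixes P :: "(('a::real_algebra_1, 'b::real_algebra_1) tpair \<Rightarrow>\<^sub>0 real) \<Rightarrow> bool"
  assumes "P 0" and "\<And>u v. P u \<Longrightarrow> P v \<Longrightarrow> P (u + v)"
    and "\<And>r a b. P (r *\<^sub>R ptens a b)"
  shows "P u"
proof -
  have "P (\<Sum>a\<in>A. Poly_Mapping.lookup u a *\<^sub>R Poly_Mapping.single a (1::real))" if "finite A" for A
    using that
  proof induction
    case (insert t A)
    then show ?case using assms(2,3) by (cases t) (simp add: ptens_def)
  qed (simp add: assms(1))
  from this[OF finite_keys, of u] show ?thesis by (subst poly_mapping_expand)
qed

lemma tensor_null_mult:
  assumes "u \<in> tensor_null"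
  shows "v * u \<in> tensor_null" and "u * v \<in> tensor_null"
proof -
  have rel: "ptens a b * u \<in> tensor_null \<and> u * ptens a b \<in> tensor_null"
    if "u \<in> tensor_rels" for a b u
  proof -
    from that have "ptens a b * u \<in> tensor_rels \<and> u * ptens a b \<in> tensor_rels"
      by cases
        (use tensor_rels.intros in \<open>auto simp: right_diff_distrib left_diff_distrib ptens_mult
          distrib_left distrib_right\<close>)
    then show ?thesis by (simp add: tensor_null_def span_base)
  qed
  have *: "ptens a b * u \<in> tensor_null \<and> u * ptens a b \<in> tensor_null" for a b
    using assms unfolding tensor_null_def[of]
  proof (induction rule: span_induct_alt)
    case base
    then show ?case by (simp add: span_zero)
  next
    case (step c x y)
    with rel[OF step(1), of a b] show ?case
      by (simp add: distrib_left distrib_right tensor_null_def span_add span_scale)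
  qed
  show "v * u \<in> tensor_null"
    by (induction v rule: ptens_induct)
      (simp_all add: distrib_right * tensor_null_ops)
  show "u * v \<in> tensor_null"
    by (induction v rule: ptens_induct)
      (simp_all add: distrib_left * tensor_null_ops)
qed

quotient_type (overloaded) ('a, 'b) tensor =
  "('a::real_algebra_1, 'b::real_algebra_1) tpair \<Rightarrow>\<^sub>0 real" / "\<lambda>u v. u - v \<in> tensor_null"
proof (rule equivpI)
  show "reflp (\<lambda>u v::('a, 'b) tpair \<Rightarrow>\<^sub>0 real. u - v \<in> tensor_null)"
    by (rule reflpI) (simp add: tensor_null_eqI)
  show "symp (\<lambda>u v::('a, 'b) tpair \<Rightarrow>\<^sub>0 real. u - v \<in> tensor_null)"
    by (rule sympI) (drule tensor_null_ops(3), simp)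
  show "transp (\<lambda>u v::('a, 'b) tpair \<Rightarrow>\<^sub>0 real. u - v \<in> tensor_null)"
    by (rule transpI) (drule (1) tensor_null_ops(1), simp)
qed

lemma one_notin_tensor_null:
  "(1 :: ('a::real_algebra_1, 'b::real_algebra_1) tpair \<Rightarrow>\<^sub>0 real) \<notin> tensor_null"
proof
  assume one: "(1 :: ('a, 'b) tpair \<Rightarrow>\<^sub>0 real) \<in> tensor_null"
  have "\<exists>f :: 'a \<Rightarrow> real. linear f \<and> (\<forall>x\<in>{1}. f x = 1)"
    by (rule linear_independent_extend) simp
  then obtain f :: "'a \<Rightarrow> real" where f: "linear f" "f 1 = 1" by auto
  have "\<exists>g :: 'b \<Rightarrow> real. linear g \<and> (\<forall>x\<in>{1}. g x = 1)"
    by (rule linear_independent_extend) simp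
  then obtain g :: "'b \<Rightarrow> real" where g: "linear g" "g 1 = 1" by auto
  define F where "F = lin_ext (\<lambda>t. case t of TPair a b \<Rightarrow> f a * g b)"
  have F: "linear F" unfolding F_def by (rule linear_lin_ext)
  have Fp: "F (ptens a b) = f a * g b" for a b
    by (simp add: F_def ptens_def)
  have rels: "F u = 0" if "u \<in> tensor_rels" for u
    using that
    by induction (simp_all add: linear_diff[OF F] linear_add[OF F] linear_cmul[OF F] Fp linear_add[OF f(1)]
        linear_add[OF g(1)] linear_cmul[OF f(1)] linear_cmul[OF g(1)] algebra_simps)
  from one have "F 1 = 0"
    unfolding tensor_null_def
    by (rule linear_eq_0_on_span[OF F rels, rotated])
  moreover have "1 = (ptens 1 1 :: ('a, 'b) tpair \<Rightarrow>\<^sub>0 real)"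
    by (simp add: ptens_def flip: zero_tpair_def)
  ultimately show False using Fp[of 1 1] f g by simp
qed

instantiation tensor :: (real_algebra_1, real_algebra_1) real_algebra_1
begin

lift_definition zero_tensor :: "('a, 'b) tensor" is 0 .
lift_definition one_tensor :: "('a, 'b) tensor" is 1 .
lift_definition plus_tensor :: "('a, 'b) tensor \<Rightarrow> ('a, 'b) tensor \<Rightarrow> ('a, 'b) tensor" is "(+)"
  by (drule (1) tensor_null_ops(1)) (simp add: algebra_simps)
lift_definition minus_tensor :: "('a, 'b) tensor \<Rightarrow> ('a, 'b) tensor \<Rightarrow> ('a, 'b) tensor" is "(-)"
  by (drule (1) tensor_null_ops(2)) (simp add: algebra_simps)
lift_definition uminus_tensor :: "('a, 'b) tensor \<Rightarrow> ('a, 'b) tensor" is uminus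
  by (drule tensor_null_ops(3)) simp
lift_definition scaleR_tensor :: "real \<Rightarrow> ('a, 'b) tensor \<Rightarrow> ('a, 'b) tensor" is scaleR
  by (drule tensor_null_ops(4)) (simp add: scaleR_diff_right)
lift_definition times_tensor :: "('a, 'b) tensor \<Rightarrow> ('a, 'b) tensor \<Rightarrow> ('a, 'b) tensor" is "(*)"
proof -
  fix u u' v v' :: "('a, 'b) tpair \<Rightarrow>\<^sub>0 real"
  assume "u - u' \<in> tensor_null" "v - v' \<in> tensor_null"
  then have "(u - u') * v + u' * (v - v') \<in> tensor_null"
    by (intro tensor_null_ops(1)[OF tensor_null_mult(2) tensor_null_mult(1)])
  then show "u * v - u' * v' \<in> tensor_null"
    by (simp add: algebra_simps)
qed

instance
proof
  show "(0 :: ('a, 'b) tensor) \<noteq> 1"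
    by transfer (auto dest: tensor_null_ops(3) simp: one_notin_tensor_null)
qed (transfer, rule tensor_null_eqI, simp add: algebra_simps)+

end

lift_definition tens :: "'a::real_algebra_1 \<Rightarrow> 'b::real_algebra_1 \<Rightarrow> ('a, 'b) tensor"
  (infixr \<open>\<otimes>\<close> 75) is ptens .

lemma tens_mult: "(a \<otimes> b) * (c \<otimes> d) = (a * c) \<otimes> (b * d)"
  by transfer (simp add: ptens_mult tensor_null_eqI)

lemma tens_one: "1 \<otimes> 1 = 1"
  by transfer (simp add: ptens_def tensor_null_eqI flip: zero_tpair_def)

lemma tens_add_left: "(a + a') \<otimes> b = a \<otimes> b + a' \<otimes> b"
  by transfer (simp add: tensor_null_def span_base tensor_rels.intros diff_diff_add[symmetric])

lemma tens_add_right: "a \<otimes> (b + b') = a \<otimes> b + a \<otimes> b'"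
  by transfer (simp add: tensor_null_def span_base tensor_rels.intros diff_diff_add[symmetric])

lemma tens_scaleR_left: "(r *\<^sub>R a) \<otimes> b = r *\<^sub>R (a \<otimes> b)"
  by transfer (simp add: tensor_null_def span_base tensor_rels.intros)

lemma tens_scaleR_right: "a \<otimes> (r *\<^sub>R b) = r *\<^sub>R (a \<otimes> b)"
  by transfer (simp add: tensor_null_def span_base tensor_rels.intros)

lemma linear_tens_left: "linear (\<lambda>a. a \<otimes> b)"
  by (rule linearI) (simp_all add: tens_add_left tens_scaleR_left)

lemma linear_tens_right: "linear (\<lambda>b. a \<otimes> b)"
  by (rule linearI) (simp_all add: tens_add_right tens_scaleR_right)

lemmas tens_diff_left = linear_diff[OF linear_tens_left]
lemmas tens_diff_right = linear_diff[OF linear_tens_right]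
lemmas tens_zero_left [simp] = linear_0[OF linear_tens_left]
lemmas tens_zero_right [simp] = linear_0[OF linear_tens_right]

section \<open>The Connes--Moscovici Lie algebra\<close>

text \<open>\<open>BD k\<close> stands for \<open>\<delta>\<close> with index \<open>k + 1\<close>, so that every element of the type is a
  basis vector.\<close>

datatype cm_basis = BY | BX | BD nat

fun cm_bracket :: "cm_basis \<Rightarrow> cm_basis \<Rightarrow> cm_basis \<Rightarrow>\<^sub>0 real" where
  "cm_bracket BY BX = Poly_Mapping.single BX 1"
| "cm_bracket BX BY = - Poly_Mapping.single BX 1"
| "cm_bracket BY (BD k) = real (k + 1) *\<^sub>R Poly_Mapping.single (BD k) 1"
| "cm_bracket (BD k) BY = - (real (k + 1) *\<^sub>R Poly_Mapping.single (BD k) 1)"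
| "cm_bracket BX (BD k) = Poly_Mapping.single (BD (k + 1)) 1"
| "cm_bracket (BD k) BX = - Poly_Mapping.single (BD (k + 1)) 1"
| "cm_bracket BY BY = 0"
| "cm_bracket BX BX = 0"
| "cm_bracket (BD k) (BD l) = 0"

definition cm_bil :: "(cm_basis \<Rightarrow>\<^sub>0 real) \<Rightarrow> (cm_basis \<Rightarrow>\<^sub>0 real) \<Rightarrow> cm_basis \<Rightarrow>\<^sub>0 real" where
  "cm_bil u v = lin_ext (\<lambda>a. lin_ext (\<lambda>b. cm_bracket a b) v) u"

lemma linear_cm_bil_left: "linear (\<lambda>u. cm_bil u v)"
  unfolding cm_bil_def by (rule linear_lin_ext)

lemma linear_cm_bil_right: "linear (cm_bil u)"
proof (rule linearI)
  show "cm_bil u (v + w) = cm_bil u v + cm_bil u w" for v w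
    unfolding cm_bil_def lin_ext_def[of _ u]
    by (simp add: linear_add[OF linear_lin_ext] scaleR_add_right sum.distrib)
  show "cm_bil u (r *\<^sub>R v) = r *\<^sub>R cm_bil u v" for r v
    unfolding cm_bil_def lin_ext_def[of _ u]
    by (simp add: linear_cmul[OF linear_lin_ext] scaleR_sum_right mult.commute)
qed

lemmas cm_bil_simps =
  linear_add[OF linear_cm_bil_left] linear_add[OF linear_cm_bil_right]
  linear_cmul[OF linear_cm_bil_left] linear_cmul[OF linear_cm_bil_right]
  linear_diff[OF linear_cm_bil_left] linear_diff[OF linear_cm_bil_right]
  linear_neg[OF linear_cm_bil_left] linear_neg[OF linear_cm_bil_right]
  linear_0[OF linear_cm_bil_left] linear_0[OF linear_cm_bil_right]

lemma cm_bil_single [simp]: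
  "cm_bil (Poly_Mapping.single a 1) (Poly_Mapping.single b 1) = cm_bracket a b"
  by (simp add: cm_bil_def)

lemma cm_bil_antisym: "cm_bil u v = - cm_bil v u"
proof (rule linear_eq_on_singles[where p = u])
  fix a
  show "cm_bil (Poly_Mapping.single a 1) v = - cm_bil v (Poly_Mapping.single a 1)"
  proof (rule linear_eq_on_singles[where p = v])
    fix b
    show "cm_bil (Poly_Mapping.single a 1) (Poly_Mapping.single b 1)
        = - cm_bil (Poly_Mapping.single b 1) (Poly_Mapping.single a 1)"
      by (cases a; cases b) simp_all
  qed (rule linearI; simp add: cm_bil_simps)+
qed (rule linearI; simp add: cm_bil_simps)+

lemma cm_bil_jacobi:
  "cm_bil u (cm_bil v w) + cm_bil v (cm_bil w u) + cm_bil w (cm_bil u v) = 0"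
proof -
  define J where "J u v w = cm_bil u (cm_bil v w) + cm_bil v (cm_bil w u) + cm_bil w (cm_bil u v)"
    for u v w
  have lin: "linear (\<lambda>u. J u v w)" "linear (\<lambda>v. J u v w)" "linear (\<lambda>w. J u v w)" for u v w
    unfolding J_def by (rule linearI; simp add: cm_bil_simps algebra_simps)+
  have zero: "linear (\<lambda>_. 0 :: cm_basis \<Rightarrow>\<^sub>0 real)"
    by (rule linearI) simp_all
  have J: "J (Poly_Mapping.single a 1) (Poly_Mapping.single b 1) (Poly_Mapping.single c 1) = 0"
    for a b c
    unfolding J_def
    by (cases a; cases b; cases c; simp add: cm_bil_simps)
      (rule poly_mapping_eqI; simp add: lookup_add lookup_minus lookup_single algebra_simps)+
  have "J u v w = 0"
    by (rule linear_eq_on_singles[OF lin(1) zero], rule linear_eq_on_singles[OF lin(2) zero],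
        rule linear_eq_on_singles[OF lin(3) zero], rule J)
  then show ?thesis by (simp add: J_def)
qed

typedef cm_lie = "UNIV :: (cm_basis \<Rightarrow>\<^sub>0 real) set" ..

setup_lifting type_definition_cm_lie

instantiation cm_lie :: lie_algebra
begin

lift_definition zero_cm_lie :: cm_lie is 0 .
lift_definition plus_cm_lie :: "cm_lie \<Rightarrow> cm_lie \<Rightarrow> cm_lie" is "(+)" .
lift_definition minus_cm_lie :: "cm_lie \<Rightarrow> cm_lie \<Rightarrow> cm_lie" is "(-)" .
lift_definition uminus_cm_lie :: "cm_lie \<Rightarrow> cm_lie" is uminus .
lift_definition scaleR_cm_lie :: "real \<Rightarrow> cm_lie \<Rightarrow> cm_lie" is scaleR .
lift_definition lie_cm_lie :: "cm_lie \<Rightarrow> cm_lie \<Rightarrow> cm_lie" is cm_bil .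

instance
proof
  fix x y z :: cm_lie and r q :: real
  show "x + y + z = x + (y + z)" by transfer (rule add.assoc)
  show "x + y = y + x" by transfer (rule add.commute)
  show "0 + x = x" by transfer simp
  show "- x + x = 0" by transfer simp
  show "x - y = x + - y" by transfer simp
  show "r *\<^sub>R (x + y) = r *\<^sub>R x + r *\<^sub>R y" by transfer (rule scaleR_add_right)
  show "(r + q) *\<^sub>R x = r *\<^sub>R x + q *\<^sub>R x" by transfer (rule scaleR_add_left)
  show "r *\<^sub>R q *\<^sub>R x = (r * q) *\<^sub>R x" by transfer simp
  show "1 *\<^sub>R x = x" by transfer simp
  show "lie (x + y) z = lie x z + lie y z" "lie x (y + z) = lie x y + lie x z"
    "lie (r *\<^sub>R x) y = r *\<^sub>R lie x y" "lie x (r *\<^sub>R y) = r *\<^sub>R lie x y"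
    by (transfer, rule cm_bil_simps)+
  show "lie x (lie y z) + lie y (lie z x) + lie z (lie x y) = 0"
    by transfer (rule cm_bil_jacobi)
  show "lie x x = 0"
  proof transfer
    fix u
    have "2 *\<^sub>R cm_bil u u = 0"
      using cm_bil_antisym[of u u] by (simp add: scaleR_2 eq_neg_iff_add_eq_0)
    then show "cm_bil u u = 0" by simp
  qed
qed

end

definition cm_elem :: "cm_basis \<Rightarrow> cm_lie" where
  "cm_elem b = Abs_cm_lie (Poly_Mapping.single b 1)"

lemma linear_Abs_cm_lie: "linear Abs_cm_lie"
  by (rule linearI) (simp_all add: plus_cm_lie.abs_eq scaleR_cm_lie.abs_eq eq_onp_same_args)

lemma linear_Rep_cm_lie: "linear Rep_cm_lie"
  by (rule linearI) (simp_all add: plus_cm_lie.rep_eq scaleR_cm_lie.rep_eq)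

lemma lie_cm_elem: "lie (cm_elem a) (cm_elem b) = Abs_cm_lie (cm_bracket a b)"
  by (simp add: cm_elem_def lie_cm_lie.abs_eq eq_onp_same_args)

lemma linear_eq_on_cm_elem:
  assumes "linear F" and "linear G" and "\<And>b. F (cm_elem b) = G (cm_elem b)"
  shows "F x = G x"
proof -
  have "F (Abs_cm_lie (Rep_cm_lie x)) = G (Abs_cm_lie (Rep_cm_lie x))"
    using linear_compose[OF linear_Abs_cm_lie assms(1)]
      linear_compose[OF linear_Abs_cm_lie assms(2)] assms(3)
    unfolding o_def cm_elem_def by (rule linear_eq_on_singles)
  then show ?thesis by (simp add: Rep_cm_lie_inverse)
qed


section \<open>The Connes--Moscovici algebra and its coproduct\<close>

type_synonym hcm = "cm_lie uenv"

definition cm_Y :: hcm where "cm_Y = uinc (cm_elem BY)"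
definition cm_X :: hcm where "cm_X = uinc (cm_elem BX)"

text \<open>Only the indices \<open>n \<ge> 1\<close> are meaningful: \<open>cm_delta 0\<close> coincides with \<open>cm_delta 1\<close>.\<close>

definition cm_delta :: "nat \<Rightarrow> hcm" where "cm_delta n = uinc (cm_elem (BD (n - 1)))"

abbreviation (input) comm :: "'a::ring \<Rightarrow> 'a \<Rightarrow> 'a" where "comm x y \<equiv> x * y - y * x"

lemma linear_uinc_Abs: "linear (\<lambda>u. uinc (Abs_cm_lie u))"
  using linear_compose[OF linear_Abs_cm_lie linear_uinc] by (simp add: o_def)

lemma comm_cm_elem: "comm (uinc (cm_elem a)) (uinc (cm_elem b)) = uinc (Abs_cm_lie (cm_bracket a b))"
  by (simp flip: lie_cm_elem uinc_lie)

lemma cm_relations: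
  shows "comm cm_Y cm_X = cm_X"
    and "n \<ge> 1 \<Longrightarrow> comm cm_Y (cm_delta n) = real n *\<^sub>R cm_delta n"
    and "comm (cm_delta n) (cm_delta m) = 0"
    and "n \<ge> 1 \<Longrightarrow> comm cm_X (cm_delta n) = cm_delta (n + 1)"
  by (simp_all add: cm_Y_def cm_X_def cm_delta_def comm_cm_elem linear_0[OF linear_uinc_Abs]
      linear_cmul[OF linear_uinc_Abs] flip: cm_elem_def)

definition is_cm_coproduct :: "(hcm \<Rightarrow> (hcm, hcm) tensor) \<Rightarrow> bool" where
  "is_cm_coproduct \<Delta> \<longleftrightarrow> alg_hom \<Delta>
    \<and> \<Delta> cm_Y = cm_Y \<otimes> 1 + 1 \<otimes> cm_Y
    \<and> \<Delta> cm_X = cm_X \<otimes> 1 + 1 \<otimes> cm_X + cm_delta 1 \<otimes> cm_Y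
    \<and> \<Delta> (cm_delta 1) = cm_delta 1 \<otimes> 1 + 1 \<otimes> cm_delta 1"

definition cm_coproduct :: "hcm \<Rightarrow> (hcm, hcm) tensor" where
  "cm_coproduct = (THE \<Delta>. is_cm_coproduct \<Delta>)"

inductive_set subalgebra_gen :: "'a::real_algebra_1 set \<Rightarrow> 'a set" for S where
  base: "x \<in> S \<Longrightarrow> x \<in> subalgebra_gen S"
| one: "1 \<in> subalgebra_gen S"
| add: "x \<in> subalgebra_gen S \<Longrightarrow> y \<in> subalgebra_gen S \<Longrightarrow> x + y \<in> subalgebra_gen S"
| scaleR: "x \<in> subalgebra_gen S \<Longrightarrow> r *\<^sub>R x \<in> subalgebra_gen S"
| mult: "x \<in> subalgebra_gen S \<Longrightarrow> y \<in> subalgebra_gen S \<Longrightarrow> x * y \<in> subalgebra_gen S"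

definition cm_H1 :: "hcm set" where
  "cm_H1 = subalgebra_gen {cm_delta n | n. n \<ge> 1}"

text \<open>The tensor square of the subalgebra, as a subspace of the tensor square of the whole algebra.\<close>

definition cm_H1_tensor :: "(hcm, hcm) tensor set" where
  "cm_H1_tensor = span {a \<otimes> b | a b. a \<in> cm_H1 \<and> b \<in> cm_H1}"

lemma cm_delta_in_H1: "n \<ge> 1 \<Longrightarrow> cm_delta n \<in> cm_H1"
  unfolding cm_H1_def by (rule subalgebra_gen.base) blast

lemma cm_H1_ops:
  "1 \<in> cm_H1" "0 \<in> cm_H1"
  "a \<in> cm_H1 \<Longrightarrow> b \<in> cm_H1 \<Longrightarrow> a + b \<in> cm_H1"
  "a \<in> cm_H1 \<Longrightarrow> b \<in> cm_H1 \<Longrightarrow> a * b \<in> cm_H1"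
  "a \<in> cm_H1 \<Longrightarrow> r *\<^sub>R a \<in> cm_H1"
proof -
  have "0 *\<^sub>R 1 \<in> cm_H1"
    unfolding cm_H1_def by (rule subalgebra_gen.scaleR[OF subalgebra_gen.one])
  then show "0 \<in> cm_H1" by simp
qed (auto simp: cm_H1_def intro: subalgebra_gen.intros)

lemma subalgebra_gen_commute1:
  assumes "u \<in> subalgebra_gen S" and "\<And>x. x \<in> S \<Longrightarrow> x * y = y * x"
  shows "u * y = y * u"
  using assms(1)
proof induction
  case (mult x z)
  then show ?case by (metis mult.assoc)
qed (simp_all add: assms(2) algebra_simps)

lemma cm_H1_commute:
  assumes "u \<in> cm_H1" and "v \<in> cm_H1"
  shows "u * v = v * u"
proof (rule subalgebra_gen_commute1[OF assms(1)[unfolded cm_H1_def]])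
  fix x assume "x \<in> {cm_delta n | n. n \<ge> 1}"
  then obtain n where x: "x = cm_delta n" by blast
  have "v * x = x * v"
    by (rule subalgebra_gen_commute1[OF assms(2)[unfolded cm_H1_def]])
      (use cm_relations(3) in \<open>auto simp: x\<close>)
  then show "x * v = v * x" by simp
qed

lemma comm_mult: "comm x (y * z) = comm x y * z + y * comm x z" for x :: "'a::ring"
  by (simp add: algebra_simps)

lemma comm_linear:
  fixes x :: "'a::real_algebra_1"
  shows "comm x (y + z) = comm x y + comm x z" "comm x (r *\<^sub>R y) = r *\<^sub>R comm x y"
    "comm (y + z) x = comm y x + comm z x" "comm (r *\<^sub>R y) x = r *\<^sub>R comm y x"
  by (simp_all add: algebra_simps)

lemma cm_H1_comm_stable:
  assumes "\<And>n. n \<ge> 1 \<Longrightarrow> comm z (cm_delta n) \<in> cm_H1" and "u \<in> cm_H1"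
  shows "comm z u \<in> cm_H1"
  using assms(2)[unfolded cm_H1_def]
proof induction
  case (base x)
  then show ?case using assms(1) by auto
next
  case one
  then show ?case by (simp add: cm_H1_ops)
next
  case (add x y)
  then show ?case by (simp only: comm_linear cm_H1_ops)
next
  case (scaleR x r)
  then show ?case by (simp only: comm_linear cm_H1_ops)
next
  case (mult x y)
  then show ?case unfolding comm_mult
    by (intro cm_H1_ops) (simp_all add: cm_H1_def)
qed

lemma comm_X_H1: "u \<in> cm_H1 \<Longrightarrow> comm cm_X u \<in> cm_H1"
  by (rule cm_H1_comm_stable) (simp_all only: cm_relations cm_delta_in_H1 le_add2)

lemma comm_Y_H1: "u \<in> cm_H1 \<Longrightarrow> comm cm_Y u \<in> cm_H1"
  by (rule cm_H1_comm_stable) (simp_all only: cm_relations cm_delta_in_H1 cm_H1_ops)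

lemma cm_H1_tensor_tens: "a \<in> cm_H1 \<Longrightarrow> b \<in> cm_H1 \<Longrightarrow> a \<otimes> b \<in> cm_H1_tensor"
  unfolding cm_H1_tensor_def by (rule span_base) blast

lemma cm_H1_tensor_ops:
  "u \<in> cm_H1_tensor \<Longrightarrow> v \<in> cm_H1_tensor \<Longrightarrow> u + v \<in> cm_H1_tensor"
  "u \<in> cm_H1_tensor \<Longrightarrow> r *\<^sub>R u \<in> cm_H1_tensor"
  "0 \<in> cm_H1_tensor"
  by (simp_all add: cm_H1_tensor_def span_add span_scale span_zero)

lemma cm_H1_tensor_induct [consumes 1, case_names zero step]:
  assumes "u \<in> cm_H1_tensor" and "P 0"
    and "\<And>r a b u. a \<in> cm_H1 \<Longrightarrow> b \<in> cm_H1 \<Longrightarrow> u \<in> cm_H1_tensor \<Longrightarrow> P u \<Longrightarrow> P (r *\<^sub>R (a \<otimes> b) + u)"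
  shows "P u"
proof -
  have "u \<in> cm_H1_tensor \<and> P u"
    using assms(1) unfolding cm_H1_tensor_def[of]
  proof (induction rule: span_induct_alt)
    case base
    then show ?case by (simp add: assms(2) span_zero)
  next
    case (step r x y)
    then obtain a b where x: "x = a \<otimes> b" "a \<in> cm_H1" "b \<in> cm_H1" by blast
    have "y \<in> cm_H1_tensor" "P y" using step by (simp_all add: cm_H1_tensor_def)
    then have "r *\<^sub>R x + y \<in> cm_H1_tensor" "P (r *\<^sub>R x + y)"
      using x assms(3) by (simp_all add: cm_H1_tensor_ops cm_H1_tensor_tens)
    then show ?case by (simp add: cm_H1_tensor_def)
  qed
  then show ?thesis ..
qed

lemma cm_H1_tensor_mult:
  assumes "u \<in> cm_H1_tensor" and "v \<in> cm_H1_tensor"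
  shows "u * v \<in> cm_H1_tensor"
  using assms(1)
proof (induction u rule: cm_H1_tensor_induct)
  case (step r a b u)
  have "(a \<otimes> b) * v \<in> cm_H1_tensor"
    using assms(2)
    by (induction v rule: cm_H1_tensor_induct)
      (simp_all add: distrib_left tens_mult cm_H1_tensor_ops cm_H1_tensor_tens cm_H1_ops step)
  then show ?case using step by (simp add: distrib_right cm_H1_tensor_ops)
qed (simp add: cm_H1_tensor_ops)

lemma cm_H1_tensor_commute:
  assumes "u \<in> cm_H1_tensor" and "v \<in> cm_H1_tensor"
  shows "u * v = v * u"
  using assms(1)
proof (induction u rule: cm_H1_tensor_induct)
  case (step r a b u)
  have "(a \<otimes> b) * v = v * (a \<otimes> b)"
    using assms(2)
  proof (induction v rule: cm_H1_tensor_induct)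
    case inner: (step r' a' b' v)
    then show ?case
      using step cm_H1_commute[of a a'] cm_H1_commute[of b b']
      by (simp add: distrib_left distrib_right tens_mult)
  qed simp
  then show ?case using step by (simp add: distrib_right distrib_left)
qed simp

abbreviation (input) cm_dX :: "(hcm, hcm) tensor" where
  "cm_dX \<equiv> cm_X \<otimes> 1 + 1 \<otimes> cm_X + cm_delta 1 \<otimes> cm_Y"

abbreviation (input) cm_dY :: "(hcm, hcm) tensor" where
  "cm_dY \<equiv> cm_Y \<otimes> 1 + 1 \<otimes> cm_Y"

lemma comm_dX_tens:
  assumes "a \<in> cm_H1" and "b \<in> cm_H1"
  shows "comm cm_dX (a \<otimes> b)
    = comm cm_X a \<otimes> b + a \<otimes> comm cm_X b + (cm_delta 1 * a) \<otimes> comm cm_Y b"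
proof -
  have "a * cm_delta 1 = cm_delta 1 * a"
    using cm_H1_commute[OF assms(1) cm_delta_in_H1[of 1]] by simp
  then show ?thesis
    by (simp add: distrib_left distrib_right tens_mult tens_diff_left tens_diff_right)
qed

lemma comm_dX_H1_tensor:
  assumes "u \<in> cm_H1_tensor"
  shows "comm cm_dX u \<in> cm_H1_tensor"
  using assms
proof (induction rule: cm_H1_tensor_induct)
  case (step r a b u)
  have "comm cm_dX (a \<otimes> b) \<in> cm_H1_tensor"
    unfolding comm_dX_tens[OF step(1,2)]
    by (intro cm_H1_tensor_ops cm_H1_tensor_tens comm_X_H1 comm_Y_H1 cm_H1_ops
        cm_delta_in_H1 step order_refl)
  then show ?case
    using step unfolding comm_linear(1,2) by (intro cm_H1_tensor_ops)
qed (simp add: cm_H1_tensor_ops)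

primrec cm_dD :: "nat \<Rightarrow> (hcm, hcm) tensor" where
  "cm_dD 0 = cm_delta 1 \<otimes> 1 + 1 \<otimes> cm_delta 1"
| "cm_dD (Suc k) = comm cm_dX (cm_dD k)"

lemma cm_dD_H1_tensor: "cm_dD k \<in> cm_H1_tensor"
proof (induction k)
  case 0
  show ?case
    by (simp add: cm_H1_tensor_ops cm_H1_tensor_tens cm_H1_ops cm_delta_in_H1)
next
  case (Suc k)
  then show ?case unfolding cm_dD.simps by (rule comm_dX_H1_tensor)
qed

lemma comm_jacobi: "comm x (comm y z) = comm (comm x y) z + comm y (comm x z)" for x :: "'a::ring"
  by (simp add: algebra_simps)

lemma comm_dY_tens: "comm cm_dY (a \<otimes> b) = comm cm_Y a \<otimes> b + a \<otimes> comm cm_Y b"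
  by (simp add: distrib_left distrib_right tens_mult tens_diff_left tens_diff_right)

lemma comm_dY_dX: "comm cm_dY cm_dX = cm_dX"
  unfolding comm_linear(1) comm_dY_tens cm_relations(1) cm_relations(2)[OF order_refl]
  by simp

lemma comm_dY_dD: "comm cm_dY (cm_dD k) = real (k + 1) *\<^sub>R cm_dD k"
proof (induction k)
  case 0
  show ?case
    unfolding cm_dD.simps comm_linear(1) comm_dY_tens cm_relations(2)[OF order_refl] by simp
next
  case (Suc k)
  show ?case
    unfolding cm_dD.simps comm_jacobi[of cm_dY] comm_dY_dX Suc comm_linear(2)
    by (simp add: scaleR_left_distrib scaleR_2)
qed

primrec cm_dB :: "cm_basis \<Rightarrow> (hcm, hcm) tensor" where
  "cm_dB BY = cm_dY"
| "cm_dB BX = cm_dX"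
| "cm_dB (BD k) = cm_dD k"

lemma lin_ext_cm_bracket: "lin_ext cm_dB (cm_bracket a b) = comm (cm_dB a) (cm_dB b)"
proof -
  have neg: "lin_ext cm_dB (- u) = - lin_ext cm_dB u" for u
    by (rule linear_neg[OF linear_lin_ext])
  have anti: "comm x y = - comm y x" for x y :: "(hcm, hcm) tensor" by simp
  note simps = cm_bracket.simps cm_dB.simps lin_ext_single neg
    linear_cmul[OF linear_lin_ext] linear_0[OF linear_lin_ext] scaleR_one
  have XD: "comm cm_dX (cm_dD k) = cm_dD (k + 1)" for k by simp
  show ?thesis
  proof (cases a; cases b; hypsubst)
    show "lin_ext cm_dB (cm_bracket BY BX) = comm (cm_dB BY) (cm_dB BX)"
      unfolding simps comm_dY_dX ..
    show "lin_ext cm_dB (cm_bracket BX BY) = comm (cm_dB BX) (cm_dB BY)"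
      unfolding simps anti[of cm_dX cm_dY] comm_dY_dX ..
    fix k l
    show "lin_ext cm_dB (cm_bracket BY (BD k)) = comm (cm_dB BY) (cm_dB (BD k))"
      unfolding simps comm_dY_dD ..
    show "lin_ext cm_dB (cm_bracket (BD k) BY) = comm (cm_dB (BD k)) (cm_dB BY)"
      unfolding simps anti[of _ cm_dY] comm_dY_dD ..
    show "lin_ext cm_dB (cm_bracket BX (BD k)) = comm (cm_dB BX) (cm_dB (BD k))"
      unfolding simps XD ..
    show "lin_ext cm_dB (cm_bracket (BD k) BX) = comm (cm_dB (BD k)) (cm_dB BX)"
      unfolding simps anti[of _ cm_dX] XD ..
    show "lin_ext cm_dB (cm_bracket (BD k) (BD l)) = comm (cm_dB (BD k)) (cm_dB (BD l))"
      unfolding simps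
      by (simp add: cm_H1_tensor_commute[OF cm_dD_H1_tensor cm_dD_H1_tensor, of k l])
  qed (simp_all add: linear_0[OF linear_lin_ext])
qed

lemma is_cm_coproduct_delta:
  assumes "is_cm_coproduct \<Delta>"
  shows "\<Delta> (cm_delta (Suc k)) = cm_dD k"
proof (induction k)
  case 0
  then show ?case using assms by (simp add: is_cm_coproduct_def)
next
  case (Suc k)
  have hom: "alg_hom \<Delta>" and X: "\<Delta> cm_X = cm_dX"
    using assms by (simp_all add: is_cm_coproduct_def)
  have "\<Delta> (comm cm_X (cm_delta (Suc k))) = comm (\<Delta> cm_X) (\<Delta> (cm_delta (Suc k)))"
    by (simp only: alg_homD(3,5)[OF hom])
  then show ?case
    using cm_relations(4)[of "Suc k"] unfolding X Suc by simp
qed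

theorem cm_coproduct_ex1: "\<exists>!\<Delta>. is_cm_coproduct \<Delta>"
proof (rule ex_ex1I)
  define f where "f x = lin_ext cm_dB (Rep_cm_lie x)" for x
  have lin: "linear f"
    using linear_compose[OF linear_Rep_cm_lie linear_lin_ext] by (simp add: f_def[abs_def] o_def)
  have elem: "f (cm_elem b) = cm_dB b" for b
    by (simp add: f_def cm_elem_def Abs_cm_lie_inverse)
  have base: "f (lie (cm_elem a) (cm_elem b)) = comm (f (cm_elem a)) (f (cm_elem b))" for a b
    unfolding elem lin_ext_cm_bracket[symmetric] lie_cm_elem
    by (simp add: f_def Abs_cm_lie_inverse)
  have "f (lie x y) = comm (f x) (f y)" for x y
  proof (rule linear_eq_on_cm_elem[where x = x])
    fix a
    show "f (lie (cm_elem a) y) = comm (f (cm_elem a)) (f y)"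
    proof (rule linear_eq_on_cm_elem[where x = y])
      show "f (lie (cm_elem a) (cm_elem b)) = comm (f (cm_elem a)) (f (cm_elem b))" for b
        by (rule base)
    qed (rule linearI; simp add: lie_add_right lie_scaleR_right linear_add[OF lin]
        linear_cmul[OF lin] algebra_simps)+
  qed (rule linearI; simp add: lie_add_left lie_scaleR_left linear_add[OF lin]
      linear_cmul[OF lin] algebra_simps)+
  then obtain \<Delta> where \<Delta>: "alg_hom \<Delta>" "\<And>x. \<Delta> (uinc x) = f x"
    using uenv_universal[OF lin] by blast
  have "is_cm_coproduct \<Delta>"
    unfolding is_cm_coproduct_def
    by (simp add: \<Delta>(1)) (simp add: cm_Y_def cm_X_def cm_delta_def \<Delta> elem)
  then show "\<exists>\<Delta>. is_cm_coproduct \<Delta>" by blast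
next
  fix \<Delta> \<Delta>'
  assume D: "is_cm_coproduct \<Delta>" "is_cm_coproduct \<Delta>'"
  then have hom: "alg_hom \<Delta>" "alg_hom \<Delta>'" by (simp_all add: is_cm_coproduct_def)
  have lin: "linear (\<lambda>x. F (uinc x))" if "alg_hom F" for F :: "hcm \<Rightarrow> (hcm, hcm) tensor"
    using linear_compose[OF linear_uinc alg_homD(1)[OF that]] by (simp add: o_def)
  have "\<Delta> (uinc x) = \<Delta>' (uinc x)" for x
  proof (rule linear_eq_on_cm_elem[OF lin[OF hom(1)] lin[OF hom(2)]])
    fix b
    show "\<Delta> (uinc (cm_elem b)) = \<Delta>' (uinc (cm_elem b))"
    proof (cases b)
      case (BD k)
      then show ?thesis
        using is_cm_coproduct_delta[OF D(1), of k] is_cm_coproduct_delta[OF D(2), of k]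
        by (simp add: cm_delta_def)
    qed (use D in \<open>simp_all add: is_cm_coproduct_def flip: cm_X_def cm_Y_def\<close>)
  qed
  then show "\<Delta> = \<Delta>'" by (rule alg_hom_uenv_eq[OF hom])
qed

lemma is_cm_coproduct: "is_cm_coproduct cm_coproduct"
  unfolding cm_coproduct_def by (rule theI'[OF cm_coproduct_ex1])

lemma cm_coproduct_H1:
  assumes "u \<in> cm_H1"
  shows "cm_coproduct u \<in> cm_H1_tensor"
proof -
  have hom: "alg_hom cm_coproduct"
    using is_cm_coproduct by (simp add: is_cm_coproduct_def)
  show ?thesis
    using assms unfolding cm_H1_def
  proof induction
    case (base x)
    then obtain n where "x = cm_delta n" "n \<ge> 1" by blast
    then show ?case
      using is_cm_coproduct_delta[OF is_cm_coproduct, of "n - 1"] cm_dD_H1_tensor by simp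
  next
    case one
    have "1 \<otimes> 1 \<in> cm_H1_tensor" by (intro cm_H1_tensor_tens cm_H1_ops)
    then show ?case by (simp add: alg_homD[OF hom] tens_one)
  qed (simp_all add: alg_homD[OF hom] cm_H1_tensor_ops cm_H1_tensor_mult)
qed


section \<open>Sequences of positive integers\<close>

definition seqs :: "nat list set" where
  "seqs = {ns. ns \<noteq> [] \<and> (\<forall>k\<in>set ns. k \<ge> 1)}"

definition seqs_of :: "nat \<Rightarrow> nat list set" where
  "seqs_of n = {ns \<in> seqs. sum_list ns = n}"

definition seq_splits :: "nat \<Rightarrow> nat list \<Rightarrow> nat list list set" where
  "seq_splits t ns = {nss. length nss = t \<and> set nss \<subseteq> seqs \<and> concat nss = ns}"

definition cm_A :: "nat list list \<Rightarrow> real" where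
  "cm_A nss = 1 / (\<Prod>ns\<leftarrow>nss. fact (length ns)) * (\<Prod>ns\<leftarrow>nss. 1 / (real (sum_list ns) + 1))"

definition cm_alpha :: "nat list \<Rightarrow> nat \<Rightarrow> real" where
  "cm_alpha ns m = (\<Sum>t=1..length ns. real (m choose t) * (\<Sum>nss\<in>seq_splits t ns. cm_A nss))"

definition split_last_seqs_of :: "nat \<Rightarrow> (nat list \<times> nat) set" where
  "split_last_seqs_of n = {(ns, m). ns @ [m] \<in> seqs_of n \<and> length ns \<ge> 1}"

text \<open>All the index sets above are finite, so none of the sums is junk.\<close>

lemma length_le_sum_list: "\<forall>k\<in>set ns. k \<ge> 1 \<Longrightarrow> length ns \<le> sum_list ns" for ns :: "nat list"
  by (induction ns) auto

lemma finite_seqs_of: "finite (seqs_of n)"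
proof (rule finite_subset)
  show "seqs_of n \<subseteq> {ns. set ns \<subseteq> {..n} \<and> length ns \<le> n}"
    using length_le_sum_list member_le_sum_list by (fastforce simp: seqs_of_def seqs_def)
qed (simp add: finite_lists_length_le)

lemma finite_split_last_seqs_of: "finite (split_last_seqs_of n)"
proof (rule finite_subset)
  show "split_last_seqs_of n \<subseteq> (\<lambda>ns. (butlast ns, last ns)) ` seqs_of n"
    by (force simp: split_last_seqs_of_def)
qed (simp add: finite_seqs_of)

lemma finite_seq_splits: "finite (seq_splits t ns)"
proof (rule finite_subset)
  show "seq_splits t ns \<subseteq> {nss. set nss \<subseteq> {xs. set xs \<subseteq> set ns \<and> length xs \<le> length ns} \<and> length nss = t}"
  proof safe
    fix nss assume nss: "nss \<in> seq_splits t ns"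
    then show "length nss = t" by (simp add: seq_splits_def)
    fix xs assume xs: "xs \<in> set nss"
    show "x \<in> set ns" if "x \<in> set xs" for x
      using nss xs that by (auto simp: seq_splits_def)
    show "length xs \<le> length ns"
      using nss xs by (auto simp: seq_splits_def length_concat intro!: member_le_sum_list)
  qed
qed (simp add: finite_lists_length_eq finite_lists_length_le)

end

theory Submission
  imports Defs "HOL-Computational_Algebra.Formal_Power_Series"
begin

text \<open>Let \<open>D = [X, _]\<close> on the commutative algebra generated by the \<open>\<delta>\<^sub>k\<close>, so that
  \<open>D \<delta>\<^sub>k = \<delta>\<^bsub>k+1\<^esub>\<close>, and put \<open>d(x) = \<Sum>\<^sub>k \<delta>\<^sub>k x\<^sup>k / k!\<close> and \<open>\<psi>(x) = \<integral> exp(d(x)) dx\<close> with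
  \<open>\<psi>(0) = 0\<close>. The derivation \<open>\<partial> = d/dx - D\<close> of power series (called \<open>pd\<close> below) satisfies
  \<open>\<partial> d = \<delta>\<^sub>1\<close>, hence \<open>\<partial> exp(d) = \<delta>\<^sub>1 exp(d)\<close>, \<open>\<partial> \<psi> = 1 + \<delta>\<^sub>1 \<psi>\<close> and
  \<open>\<partial> (\<psi>\<^sup>m / m!) = \<psi>\<^bsup>m-1\<^esup> / (m-1)! + m \<delta>\<^sub>1 \<psi>\<^sup>m / m!\<close>. At the level of coefficients this is the
  recursion that \<open>\<delta>\<^bsub>n+1\<^esub> = [X, \<delta>\<^sub>n]\<close> imposes on the left tensor factors of \<open>\<Delta>(\<delta>\<^sub>n)\<close>, so the factor
  paired with \<open>\<delta>\<^sub>m\<close> is \<open>n!\<close> times the coefficient of \<open>x\<^sup>n\<close> in \<open>\<psi>\<^sup>m / m!\<close>. Writing \<open>\<psi> = x (1 + G)\<close>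
  and expanding \<open>(1 + G)\<^sup>m\<close> binomially yields the sum over \<open>t\<close> in \<open>cm_alpha\<close>: the power \<open>G\<^sup>t\<close>
  runs over the splittings of a sequence into \<open>t\<close> nonempty blocks.\<close>

unbundle fps_syntax

section \<open>Powers of power series as sums over lists\<close>

text \<open>Used twice: with positive integers as entries for the powers of \<open>d_series\<close>,
  and with whole blocks as entries for the powers of \<open>block_series\<close>.\<close>

definition weighted_lists :: "'b set \<Rightarrow> ('b \<Rightarrow> nat) \<Rightarrow> nat \<Rightarrow> nat \<Rightarrow> 'b list set" where
  "weighted_lists S wt t n = {xs. set xs \<subseteq> S \<and> length xs = t \<and> sum_list (map wt xs) = n}"

lemma weighted_lists_0: "weighted_lists S wt 0 n = (if n = 0 then {[]} else {})"
  by (auto simp: weighted_lists_def)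

lemma weighted_lists_Suc:
  "weighted_lists S wt (Suc t) n
    = (\<lambda>(i, x, xs). x # xs) ` (SIGMA i:{0..n}. {x \<in> S. wt x = i} \<times> weighted_lists S wt t (n - i))"
  (is "?L = ?f ` ?R")
proof
  show "?L \<subseteq> ?f ` ?R"
  proof
    fix ys assume "ys \<in> ?L"
    then obtain x xs where "ys = x # xs" "(wt x, x, xs) \<in> ?R"
      by (cases ys) (auto simp: weighted_lists_def)
    then show "ys \<in> ?f ` ?R" by force
  qed
qed (auto simp: weighted_lists_def)

lemma finite_weighted_lists:
  assumes "\<And>n. finite {x \<in> S. wt x = n}"
  shows "finite (weighted_lists S wt t n)"
  by (induction t arbitrary: n) (simp_all add: weighted_lists_0 weighted_lists_Suc assms)

text \<open>Expanding the Cauchy product: the first factor picks an entry x of weight i, and the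
  other t factors share the remaining weight n - i.\<close>

lemma fps_power_nth_weighted_lists:
  fixes f :: "'b \<Rightarrow> 'a::semiring_1"
  assumes fin: "\<And>n. finite {x \<in> S. wt x = n}"
  shows "(Abs_fps (\<lambda>n. \<Sum>x | x \<in> S \<and> wt x = n. f x) ^ t) $ n
    = (\<Sum>xs\<in>weighted_lists S wt t n. prod_list (map f xs))"
proof (induction t arbitrary: n)
  case 0
  then show ?case by (simp add: weighted_lists_0)
next
  case (Suc t)
  let ?R = "SIGMA i:{0..n}. {x \<in> S. wt x = i} \<times> weighted_lists S wt t (n - i)"
  have inj: "inj_on (\<lambda>(i, x, xs). x # xs) ?R" by (auto simp: inj_on_def)
  have "(\<Sum>ys\<in>weighted_lists S wt (Suc t) n. prod_list (map f ys))
      = (\<Sum>(i, x, xs)\<in>?R. f x * prod_list (map f xs))"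
    unfolding weighted_lists_Suc by (subst sum.reindex[OF inj]) (simp add: split_def)
  also have "\<dots> = (\<Sum>i=0..n. (\<Sum>x | x \<in> S \<and> wt x = i. f x)
      * (\<Sum>xs\<in>weighted_lists S wt t (n - i). prod_list (map f xs)))"
    by (simp add: sum_product sum.cartesian_product finite_weighted_lists fin sum.Sigma)
  finally show ?case by (simp add: fps_mult_nth Suc)
qed


section \<open>The generating series of the coefficients\<close>

text \<open>Index 0 is left out of the shift rule because \<open>cm_delta 0\<close> is only an alias
  of \<open>cm_delta 1\<close>.\<close>

locale shift_derivation =
  fixes D :: "'a::{comm_ring_1, real_algebra_1} \<Rightarrow> 'a" and \<delta> :: "nat \<Rightarrow> 'a"
  assumes linear_D: "linear D"
    and D_mult: "D (x * y) = D x * y + x * D y"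
    and D_\<delta>: "k \<ge> 1 \<Longrightarrow> D (\<delta> k) = \<delta> (Suc k)"
begin

lemmas D_add = linear_add[OF linear_D]
lemmas D_sum = linear_sum[OF linear_D]
lemmas D_scaleR = linear_cmul[OF linear_D]
lemmas D_zero [simp] = linear_0[OF linear_D]

lemma D_one [simp]: "D 1 = 0"
  using D_mult[of 1 1] by simp

section \<open>The derivation d/dx - D and the series exp(d) and \<psi>\<close>

definition pd :: "'a fps \<Rightarrow> 'a fps" where
  "pd f = fps_deriv f - Abs_fps (\<lambda>n. D (f $ n))"

lemma pd_nth: "pd f $ n = real (Suc n) *\<^sub>R f $ Suc n - D (f $ n)"
  by (simp add: pd_def scaleR_conv_of_real)

lemma pd_mult: "pd (f * g) = pd f * g + f * pd g"
proof -
  have "Abs_fps (\<lambda>n. D ((f * g) $ n))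
      = Abs_fps (\<lambda>n. D (f $ n)) * g + f * Abs_fps (\<lambda>n. D (g $ n))"
    by (rule fps_ext) (simp add: fps_mult_nth D_sum D_mult sum.distrib)
  then show ?thesis by (simp add: pd_def algebra_simps)
qed

lemma pd_one: "pd 1 = 0"
  by (rule fps_ext) (simp add: pd_nth)

lemma pd_power: "pd (f ^ Suc m) = of_nat (Suc m) * f ^ m * pd f"
proof (induction m)
  case 0
  then show ?case by simp
next
  case (Suc m)
  show ?case by (subst power_Suc, subst pd_mult, subst Suc) (simp add: algebra_simps)
qed

definition d_series :: "'a fps" where
  "d_series = Abs_fps (\<lambda>n. if n = 0 then 0 else (1 / fact n) *\<^sub>R \<delta> n)"

text \<open>The finite sum is all of exp(d): since d has no constant term,
  \<open>d_series ^ s\<close> has no coefficient below s.\<close>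

definition exp_series :: "'a fps" where
  "exp_series = Abs_fps (\<lambda>n. \<Sum>s\<le>n. (1 / fact s) *\<^sub>R (d_series ^ s) $ n)"

definition psi :: "'a fps" where
  "psi = Abs_fps (\<lambda>n. if n = 0 then 0 else (1 / real n) *\<^sub>R exp_series $ (n - 1))"

text \<open>d/dx and D both shift the index of \<delta> by one, so they cancel in every degree but
  0, where d has no term for D to act on.\<close>

lemma pd_d_series: "pd d_series = fps_const (\<delta> 1)"
  by (rule fps_ext) (auto simp: pd_nth d_series_def D_scaleR D_\<delta> divide_simps)

lemma exp_series_0: "exp_series $ 0 = 1"
  by (simp add: exp_series_def)

lemma pd_exp_series: "pd exp_series = fps_const (\<delta> 1) * exp_series"
proof (rule fps_ext)
  fix n
  have "d_series $ 0 = 0" by (simp add: d_series_def)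
  then have "(d_series ^ Suc n) $ n = 0"
    using startsby_zero_power_prefix by blast
  \<comment> \<open>\<open>pd\<close> compares coefficients n and n + 1, so both are summed up to
    \<open>Suc n\<close>; the added term is zero.\<close>
  then have "exp_series $ n = (\<Sum>s\<le>Suc n. (1 / fact s) *\<^sub>R (d_series ^ s) $ n)"
    by (simp add: exp_series_def)
  then have "pd exp_series $ n = (\<Sum>s\<le>Suc n. (1 / fact s) *\<^sub>R pd (d_series ^ s) $ n)"
    by (simp add: pd_nth exp_series_def D_sum D_scaleR scaleR_sum_right sum_subtractf
        scaleR_diff_right scaleR_add_right D_add mult.commute del: of_nat_Suc)
  also have "\<dots> = (\<Sum>s\<le>n. (1 / fact (Suc s)) *\<^sub>R pd (d_series ^ Suc s) $ n)"
    by (subst sum.atMost_Suc_shift) (simp add: pd_one del: power_Suc)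
  also have "\<dots> = (\<Sum>s\<le>n. (1 / fact s) *\<^sub>R (fps_const (\<delta> 1) * d_series ^ s) $ n)"
  proof (rule sum.cong)
    fix s
    have "pd (d_series ^ Suc s) $ n = real (Suc s) *\<^sub>R (fps_const (\<delta> 1) * d_series ^ s) $ n"
      by (subst pd_power)
        (simp add: pd_d_series scaleR_conv_of_real mult_ac flip: fps_of_nat del: of_nat_Suc)
    then show "(1 / fact (Suc s)) *\<^sub>R pd (d_series ^ Suc s) $ n
        = (1 / fact s) *\<^sub>R (fps_const (\<delta> 1) * d_series ^ s) $ n"
      by (simp add: divide_simps del: of_nat_Suc)
  qed simp
  also have "\<dots> = (fps_const (\<delta> 1) * exp_series) $ n"
    by (simp add: exp_series_def sum_distrib_left)
  finally show "pd exp_series $ n = (fps_const (\<delta> 1) * exp_series) $ n" .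
qed

text \<open>This integrates \<open>pd_exp_series\<close>: its coefficient k divided by k + 1 gives
  degree k + 1, and degree 0 contributes the 1.\<close>

lemma pd_psi: "pd psi = 1 + fps_const (\<delta> 1) * psi"
proof (rule fps_ext)
  fix n
  show "pd psi $ n = (1 + fps_const (\<delta> 1) * psi) $ n"
  proof (cases n)
    case 0
    then show ?thesis by (simp add: pd_nth psi_def exp_series_0)
  next
    case (Suc k)
    have "real (Suc k) *\<^sub>R exp_series $ Suc k = D (exp_series $ k) + \<delta> 1 * exp_series $ k"
      using arg_cong[OF pd_exp_series, of "\<lambda>f. f $ k"]
      by (simp only: pd_nth fps_mult_left_const_nth diff_eq_eq add.commute)
    then have "(1 / real (Suc k)) *\<^sub>R (real (Suc k) *\<^sub>R exp_series $ Suc k)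
        = (1 / real (Suc k)) *\<^sub>R (D (exp_series $ k) + \<delta> 1 * exp_series $ k)"
      by (rule arg_cong)
    then show ?thesis
      by (simp add: Suc pd_nth psi_def D_scaleR scaleR_add_right del: of_nat_Suc)
  qed
qed

section \<open>Recursion for the left tensor factors\<close>

text \<open>The partial exponential Bell polynomial \<open>B_{n,m}\<close> in the coefficients k!
  [x^k] of \<open>psi\<close>.\<close>

definition psi_coeff :: "nat \<Rightarrow> nat \<Rightarrow> 'a" where
  "psi_coeff m n = (fact n / fact m) *\<^sub>R (psi ^ m) $ n"

lemma psi_coeff_eq_0: "n < m \<Longrightarrow> psi_coeff m n = 0"
  using startsby_zero_power_prefix[of psi m] by (simp add: psi_coeff_def psi_def)

lemma psi_coeff_0: "n \<ge> 1 \<Longrightarrow> psi_coeff 0 n = 0"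
  by (simp add: psi_coeff_def)

text \<open>The three terms mirror the summands X \<otimes> 1, 1 \<otimes> X and \<delta>_1
  \<otimes> Y of the coproduct of X.\<close>

lemma psi_coeff_Suc:
  "psi_coeff (Suc m) (Suc n)
    = D (psi_coeff (Suc m) n) + psi_coeff m n + real (Suc m) *\<^sub>R (\<delta> 1 * psi_coeff (Suc m) n)"
proof -
  let ?c = "fact n / fact (Suc m) :: real"
  have "pd (psi ^ Suc m) = of_nat (Suc m) * (psi ^ m + fps_const (\<delta> 1) * psi ^ Suc m)"
    by (subst pd_power) (simp add: pd_psi algebra_simps)
  then have "pd (psi ^ Suc m) $ n
      = real (Suc m) *\<^sub>R ((psi ^ m) $ n + \<delta> 1 * (psi ^ Suc m) $ n)"
    by (simp add: scaleR_conv_of_real  flip: fps_of_nat del: of_nat_Suc power_Suc)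
  then have "real (Suc n) *\<^sub>R (psi ^ Suc m) $ Suc n = D ((psi ^ Suc m) $ n)
      + real (Suc m) *\<^sub>R ((psi ^ m) $ n + \<delta> 1 * (psi ^ Suc m) $ n)"
    by (simp add: pd_nth algebra_simps del: of_nat_Suc power_Suc)
  \<comment> \<open>Scaling by n!/(m+1)! turns the factor n + 1 into (n+1)!/(m+1)! and the factor m
    + 1 into n!/m!, the normalisations in \<open>psi_coeff\<close>.\<close>
  then have "?c *\<^sub>R (real (Suc n) *\<^sub>R (psi ^ Suc m) $ Suc n) = ?c *\<^sub>R (D ((psi ^ Suc m) $ n)
      + real (Suc m) *\<^sub>R ((psi ^ m) $ n + \<delta> 1 * (psi ^ Suc m) $ n))"
    by simp
  moreover have "?c * real (Suc n) = fact (Suc n) / fact (Suc m)" by simp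
  moreover have "?c * real (Suc m) = fact n / fact m"
    by (simp add: divide_simps del: of_nat_Suc)
  ultimately show ?thesis
    by (simp add: psi_coeff_def D_scaleR scaleR_add_right mult.commute[of "real (Suc m)"]
        del: of_nat_Suc power_Suc fact_Suc)
qed

section \<open>Expansion over sequences and blocks\<close>

definition word_weight :: "nat list \<Rightarrow> 'a" where
  "word_weight ns = prod_list (map (\<lambda>k. (1 / fact k) *\<^sub>R \<delta> k) ns)"

lemma word_weight_append: "word_weight (ns @ ms) = word_weight ns * word_weight ms"
  by (simp add: word_weight_def)

lemma word_weight_eq: "word_weight ns = (1 / (\<Prod>k\<leftarrow>ns. fact k)) *\<^sub>R prod_list (map \<delta> ns)"
  by (induction ns) (simp_all add: word_weight_def)

lemma d_series_power_nth: "(d_series ^ s) $ n = (\<Sum>ns\<in>weighted_lists {1..} id s n. word_weight ns)"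
proof -
  have "d_series = Abs_fps (\<lambda>n. \<Sum>k | k \<in> {1..} \<and> id k = n. (1 / fact k) *\<^sub>R \<delta> k)"
  proof (rule fps_ext)
    fix n :: nat
    have "{k \<in> {1..}. id k = n} = (if n = 0 then {} else {n})"
      by auto
    then show "d_series $ n = Abs_fps (\<lambda>n. \<Sum>k | k \<in> {1..} \<and> id k = n. (1 / fact k) *\<^sub>R \<delta> k) $ n"
      by (simp add: d_series_def)
  qed
  then show ?thesis
    unfolding word_weight_def by (simp only:) (rule fps_power_nth_weighted_lists, simp)
qed

lemma exp_series_nth:
  assumes "n \<ge> 1"
  shows "exp_series $ n = (\<Sum>ns\<in>seqs_of n. (1 / fact (length ns)) *\<^sub>R word_weight ns)"
proof -
  let ?g = "\<lambda>ns. (1 / fact (length ns)) *\<^sub>R word_weight ns"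
  have fin: "finite (weighted_lists {1::nat..} id s n)" for s
    by (rule finite_weighted_lists) simp
  have "exp_series $ n = (\<Sum>s\<le>n. \<Sum>ns\<in>weighted_lists {1..} id s n. ?g ns)"
    by (auto simp: exp_series_def d_series_power_nth scaleR_sum_right weighted_lists_def
        intro!: sum.cong)
  also have "\<dots> = (\<Sum>ns\<in>(\<Union>s\<le>n. weighted_lists {1..} id s n). ?g ns)"
    by (rule sum.UNION_disjoint[symmetric]) (use fin in \<open>auto simp: weighted_lists_def\<close>)
  \<comment> \<open>Positive entries force s \<le> n, so every length occurs; n \<ge> 1 excludes the
    empty sequence.\<close>
  also have "(\<Union>s\<le>n. weighted_lists {1..} id s n) = seqs_of n"
    using assms by (auto simp: weighted_lists_def seqs_of_def seqs_def length_le_sum_list subset_iff)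
  finally show ?thesis .
qed

text \<open>The factorial of the length comes from exp, and the factor 1/(sum + 1) from integrating
  x^sum; together they form one block's share of \<open>cm_A\<close>.\<close>

definition block_weight :: "nat list \<Rightarrow> 'a" where
  "block_weight ns = (1 / (fact (length ns) * (real (sum_list ns) + 1))) *\<^sub>R word_weight ns"

definition block_series :: "'a fps" where
  "block_series = Abs_fps (\<lambda>n. \<Sum>ns | ns \<in> seqs \<and> sum_list ns = n. block_weight ns)"

lemma block_series_nth: "block_series $ n = (\<Sum>ns\<in>seqs_of n. block_weight ns)"
  by (simp add: block_series_def seqs_of_def)

lemma seqs_of_0: "seqs_of 0 = {}"
  by (auto simp: seqs_of_def seqs_def neq_Nil_conv)

lemma psi_eq: "psi = fps_X * (1 + block_series)"
proof (rule fps_ext)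
  fix n
  show "psi $ n = (fps_X * (1 + block_series)) $ n"
  proof (cases "n \<le> 1")
    case True
    then have "n = 0 \<or> n = 1" by auto
    then show ?thesis
      by (auto simp: psi_def exp_series_0 block_series_nth seqs_of_0)
  next
    case False
    then obtain k where k: "n = Suc k" "k \<ge> 1" by (cases n) auto
    then have "psi $ n
        = (\<Sum>ns\<in>seqs_of k. (1 / (real k + 1)) *\<^sub>R (1 / fact (length ns)) *\<^sub>R word_weight ns)"
      by (simp add: psi_def exp_series_nth scaleR_sum_right add.commute)
    also have "\<dots> = block_series $ k"
      unfolding block_series_nth
      by (rule sum.cong) (simp_all add: block_weight_def seqs_of_def mult.commute)
    finally show ?thesis using k by simp
  qed
qed

lemma prod_list_block_weight:
  "prod_list (map block_weight nss) = cm_A nss *\<^sub>R word_weight (concat nss)"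
  by (induction nss)
    (simp_all add: cm_A_def block_weight_def word_weight_append, simp add: word_weight_def)

text \<open>Groups lists of blocks by their concatenation; n \<ge> 1 makes that concatenation
  nonempty.\<close>

lemma weighted_lists_seqs:
  assumes "n \<ge> 1"
  shows "weighted_lists seqs sum_list t n = (\<Union>ns\<in>seqs_of n. seq_splits t ns)"
proof -
  have concat_seqs: "concat nss \<in> seqs_of n"
    if "set nss \<subseteq> seqs" "sum_list (map sum_list nss) = n" for nss
  proof -
    have "sum_list (concat nss) = n"
      using that(2) by (induction nss arbitrary: n) auto
    moreover have "\<forall>k\<in>set (concat nss). k \<ge> 1"
      using that(1) by (auto simp: seqs_def)
    ultimately show ?thesis
      using assms by (cases "concat nss = []")
        (auto simp: seqs_of_def seqs_def simp del: concat_eq_Nil_conv set_concat)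
  qed
  have "sum_list (map sum_list nss) = sum_list (concat nss)" for nss :: "nat list list"
    by (induction nss) auto
  then show ?thesis
    using concat_seqs by (auto simp: weighted_lists_def seq_splits_def seqs_of_def)
qed

lemma block_series_power_nth:
  assumes "n \<ge> 1"
  shows "(block_series ^ t) $ n
    = (\<Sum>ns\<in>seqs_of n. (\<Sum>nss\<in>seq_splits t ns. cm_A nss) *\<^sub>R word_weight ns)"
proof -
  have fin: "finite {ns \<in> seqs. sum_list ns = n}" for n
    using finite_seqs_of[of n] by (simp add: seqs_of_def)
  have "(block_series ^ t) $ n
      = (\<Sum>nss\<in>weighted_lists seqs sum_list t n. cm_A nss *\<^sub>R word_weight (concat nss))"
    unfolding block_series_def prod_list_block_weight[symmetric]
    by (rule fps_power_nth_weighted_lists) (rule fin)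
  also have "\<dots> = (\<Sum>ns\<in>seqs_of n. \<Sum>nss\<in>seq_splits t ns. cm_A nss *\<^sub>R word_weight (concat nss))"
    unfolding weighted_lists_seqs[OF assms]
    by (rule sum.UNION_disjoint)
      (simp_all add: finite_seqs_of finite_seq_splits, auto simp: seq_splits_def)
  also have "\<dots> = (\<Sum>ns\<in>seqs_of n. (\<Sum>nss\<in>seq_splits t ns. cm_A nss) *\<^sub>R word_weight ns)"
    by (auto simp: scaleR_sum_left seq_splits_def intro!: sum.cong)
  finally show ?thesis .
qed

text \<open>Replaces the bound \<open>length ns\<close> by the bound m of the binomial theorem:
  nonempty blocks leave no splitting with t > \<open>length ns\<close> or t = 0, and the binomial
  vanishes for t > m.\<close>

lemma cm_alpha_eq:
  assumes "ns \<noteq> []"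
  shows "cm_alpha ns m = (\<Sum>t\<le>m. real (m choose t) * (\<Sum>nss\<in>seq_splits t ns. cm_A nss))"
    (is "_ = sum ?g _")
proof -
  have "length nss \<le> length (concat nss)" if "set nss \<subseteq> seqs" for nss
    using that
  proof (induction nss)
    case (Cons ns nss)
    then have "length ns \<ge> 1" by (cases ns) (auto simp: seqs_def)
    with Cons show ?case by simp
  qed simp
  then have "seq_splits t ns = {}" if "t > length ns" for t
    using that by (fastforce simp: seq_splits_def)
  then have zero: "?g t = 0" if "t > length ns" for t
    using that by simp
  have "seq_splits 0 ns = {}"
    using assms by (auto simp: seq_splits_def)
  then have zero': "?g 0 = 0"
    by simp
  have "cm_alpha ns m = sum ?g {..max m (length ns)}"
    unfolding cm_alpha_def
  proof (rule sum.mono_neutral_left)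
    show "\<forall>t\<in>{..max m (length ns)} - {1..length ns}. ?g t = 0"
      using zero zero' by (metis DiffE One_nat_def Suc_leI atLeastAtMost_iff neq0_conv not_le)
  qed auto
  also have "\<dots> = sum ?g {..m}"
    by (rule sum.mono_neutral_right) auto
  finally show ?thesis .
qed

lemma psi_power_nth:
  assumes "m < n"
  shows "(psi ^ m) $ n = (\<Sum>ns\<in>seqs_of (n - m). cm_alpha ns m *\<^sub>R word_weight ns)"
proof -
  let ?N = "n - m"
  have N: "?N \<ge> 1" using assms by simp
  have "(psi ^ m) $ n = ((1 + block_series) ^ m) $ ?N"
    using assms by (simp add: psi_eq power_mult_distrib fps_X_power_mult_nth)
  also have "(1 + block_series) ^ m = (\<Sum>t\<le>m. of_nat (m choose t) * block_series ^ t)"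
    using binomial_ring[of block_series 1 m] by (simp add: add.commute)
  also have "\<dots> $ ?N = (\<Sum>t\<le>m. real (m choose t) *\<^sub>R (block_series ^ t) $ ?N)"
    by (simp add: fps_sum_nth scaleR_conv_of_real flip: fps_of_nat)
  also have "\<dots> = (\<Sum>ns\<in>seqs_of ?N. \<Sum>t\<le>m.
      (real (m choose t) * (\<Sum>nss\<in>seq_splits t ns. cm_A nss)) *\<^sub>R word_weight ns)"
    unfolding block_series_power_nth[OF N] scaleR_sum_right by (subst sum.swap) simp
  also have "\<dots> = (\<Sum>ns\<in>seqs_of ?N. cm_alpha ns m *\<^sub>R word_weight ns)"
    by (rule sum.cong) (auto simp: cm_alpha_eq scaleR_sum_left seqs_of_def seqs_def)
  finally show ?thesis .
qed

lemma psi_coeff_diag: "psi_coeff n n = 1"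
  by (simp add: psi_coeff_def startsby_zero_power_nth_same psi_def exp_series_0)

lemma psi_coeff_eq:
  assumes "m < n"
  shows "psi_coeff m n = (\<Sum>ns\<in>seqs_of (n - m).
    (fact n / ((\<Prod>k\<leftarrow>ns. fact k) * fact m) * cm_alpha ns m) *\<^sub>R prod_list (map \<delta> ns))"
  by (simp add: psi_coeff_def psi_power_nth[OF assms] scaleR_sum_right word_weight_eq mult_ac)

end


section \<open>The coproduct\<close>

lemma cm_H1_uminus: "u \<in> cm_H1 \<Longrightarrow> - u \<in> cm_H1"
  using cm_H1_ops(5)[of u "-1"] by simp

text \<open>The whole algebra is not commutative; a type of its own lets the subalgebra be a
  commutative ring of coefficients for the locale.\<close>

typedef h1 = cm_H1
  using cm_H1_ops(1) by blast

setup_lifting type_definition_h1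

instantiation h1 :: "{comm_ring_1, real_algebra_1}"
begin

lift_definition zero_h1 :: h1 is 0 by (rule cm_H1_ops)
lift_definition one_h1 :: h1 is 1 by (rule cm_H1_ops)
lift_definition plus_h1 :: "h1 \<Rightarrow> h1 \<Rightarrow> h1" is "(+)" by (rule cm_H1_ops)
lift_definition times_h1 :: "h1 \<Rightarrow> h1 \<Rightarrow> h1" is "(*)" by (rule cm_H1_ops)
lift_definition scaleR_h1 :: "real \<Rightarrow> h1 \<Rightarrow> h1" is scaleR by (rule cm_H1_ops)
lift_definition uminus_h1 :: "h1 \<Rightarrow> h1" is uminus by (rule cm_H1_uminus)
lift_definition minus_h1 :: "h1 \<Rightarrow> h1 \<Rightarrow> h1" is "(-)"
  by (metis cm_H1_ops(3) cm_H1_uminus uminus_add_conv_diff add.commute)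

instance
proof
  show "x * y = y * x" for x y :: h1
    by transfer (rule cm_H1_commute)
qed (transfer; simp add: algebra_simps)+

end

lift_definition h1_delta :: "nat \<Rightarrow> h1" is cm_delta
  by (metis cm_delta_def cm_delta_in_H1 diff_is_0_eq' le_refl linorder_linear zero_diff)

lift_definition h1_ad_X :: "h1 \<Rightarrow> h1" is "\<lambda>u. comm cm_X u"
  by (rule comm_X_H1)

interpretation H1: shift_derivation h1_ad_X h1_delta
proof (rule shift_derivation.intro)
  show "linear h1_ad_X"
    by (rule linearI; transfer) (simp_all only: comm_linear)
  show "h1_ad_X (x * y) = h1_ad_X x * y + x * h1_ad_X y" for x y
    by transfer (rule comm_mult)
  show "h1_ad_X (h1_delta k) = h1_delta (Suc k)" if "k \<ge> 1" for k
    using that by transfer (simp add: cm_relations(4))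
qed

section \<open>Bracketing with the coproduct of X\<close>

lemma linear_Rep_h1: "linear Rep_h1"
  by (rule linearI) (simp_all add: plus_h1.rep_eq scaleR_h1.rep_eq)

lemma Rep_h1_prod_list_delta: "Rep_h1 (prod_list (map h1_delta ns)) = prod_list (map cm_delta ns)"
  by (induction ns) (simp_all add: one_h1.rep_eq times_h1.rep_eq h1_delta.rep_eq)

lemma comm_dX_tens_delta:
  assumes "k \<ge> 1"
  shows "comm cm_dX (Rep_h1 a \<otimes> cm_delta k) = Rep_h1 (h1_ad_X a) \<otimes> cm_delta k
    + Rep_h1 a \<otimes> cm_delta (Suc k) + Rep_h1 (real k *\<^sub>R (h1_delta 1 * a)) \<otimes> cm_delta k"
  using comm_dX_tens[OF Rep_h1[of a] cm_delta_in_H1[OF assms]]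
  unfolding cm_relations(2)[OF assms] cm_relations(4)[OF assms]
  by (simp add: h1_ad_X.rep_eq scaleR_h1.rep_eq times_h1.rep_eq h1_delta.rep_eq
      tens_scaleR_left tens_scaleR_right)

text \<open>\<open>cm_dD n\<close> is the coproduct of \<delta> with index n + 1. Bracketing each
  summand with \<open>cm_dX\<close> and collecting the left factors of each \<delta> reproduces
  \<open>psi_coeff_Suc\<close>.\<close>

lemma cm_dD_eq:
  "cm_dD n = cm_delta (Suc n) \<otimes> 1
    + (\<Sum>m\<le>n. Rep_h1 (H1.psi_coeff (Suc m) (Suc n)) \<otimes> cm_delta (Suc m))"
proof (induction n)
  case 0
  then show ?case by (simp add: H1.psi_coeff_diag one_h1.rep_eq)
next
  case (Suc n)
  let ?Q = "\<lambda>m n. H1.psi_coeff m n"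
  have first: "comm cm_dX (cm_delta (Suc n) \<otimes> 1) = cm_delta (Suc (Suc n)) \<otimes> 1"
    using comm_dX_tens[OF cm_delta_in_H1[of "Suc n"] cm_H1_ops(1)] cm_relations(4)[of "Suc n"]
    by simp
  have Suc_le_one: "1 \<le> Suc m" for m by simp
  have comm_sum: "comm x (\<Sum>m\<le>n. f m) = (\<Sum>m\<le>n. comm x (f m))"
    for x and f :: "nat \<Rightarrow> (hcm, hcm) tensor"
    by (simp add: sum_distrib_left sum_distrib_right sum_subtractf)
  have "cm_dD (Suc n) = cm_delta (Suc (Suc n)) \<otimes> 1
    + (\<Sum>m\<le>n. Rep_h1 (h1_ad_X (?Q (Suc m) (Suc n))) \<otimes> cm_delta (Suc m)
      + Rep_h1 (?Q (Suc m) (Suc n)) \<otimes> cm_delta (Suc (Suc m))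
      + Rep_h1 (real (Suc m) *\<^sub>R (h1_delta 1 * ?Q (Suc m) (Suc n))) \<otimes> cm_delta (Suc m))"
    unfolding cm_dD.simps Suc comm_linear(1) first comm_sum
    by (simp only: comm_dX_tens_delta[OF Suc_le_one])
  \<comment> \<open>The outer sums gain m = n + 1, where \<open>psi_coeff\<close> vanishes above the
    diagonal; the middle one is shifted and gains m = 0, where \<open>psi_coeff_0\<close>
    applies.\<close>
  also have "(\<Sum>m\<le>n. Rep_h1 (h1_ad_X (?Q (Suc m) (Suc n))) \<otimes> cm_delta (Suc m)
      + Rep_h1 (?Q (Suc m) (Suc n)) \<otimes> cm_delta (Suc (Suc m))
      + Rep_h1 (real (Suc m) *\<^sub>R (h1_delta 1 * ?Q (Suc m) (Suc n))) \<otimes> cm_delta (Suc m))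
    = (\<Sum>m\<le>Suc n. Rep_h1 (h1_ad_X (?Q (Suc m) (Suc n))) \<otimes> cm_delta (Suc m))
      + (\<Sum>m\<le>Suc n. Rep_h1 (?Q m (Suc n)) \<otimes> cm_delta (Suc m))
      + (\<Sum>m\<le>Suc n. Rep_h1 (real (Suc m) *\<^sub>R (h1_delta 1 * ?Q (Suc m) (Suc n))) \<otimes> cm_delta (Suc m))"
    by (subst (2) sum.atMost_Suc_shift)
      (simp add: sum.distrib H1.psi_coeff_eq_0 H1.psi_coeff_0 linear_0[OF linear_Rep_h1])
  also have "\<dots> = (\<Sum>m\<le>Suc n. Rep_h1 (?Q (Suc m) (Suc (Suc n))) \<otimes> cm_delta (Suc m))"
    unfolding H1.psi_coeff_Suc linear_add[OF linear_Rep_h1] tens_add_left sum.distrib ..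
  finally show ?case .
qed

text \<open>Fibres the index set over the last entry m; m < n because the remaining prefix is
  nonempty.\<close>

lemma split_last_seqs_of_eq:
  "split_last_seqs_of n = (\<lambda>(m, ns). (ns, m)) ` (SIGMA m:{1..<n}. seqs_of (n - m))"
proof
  show "split_last_seqs_of n \<subseteq> (\<lambda>(m, ns). (ns, m)) ` (SIGMA m:{1..<n}. seqs_of (n - m))"
  proof clarify
    fix ns m assume "(ns, m) \<in> split_last_seqs_of n"
    then have ns: "ns \<noteq> []" "\<forall>k\<in>set ns. k \<ge> 1" "m \<ge> 1" "sum_list ns + m = n"
      by (auto simp: split_last_seqs_of_def seqs_of_def seqs_def)
    moreover have "sum_list ns \<ge> 1"
      using ns length_le_sum_list[of ns] by (cases ns) auto
    ultimately have "(m, ns) \<in> (SIGMA m:{1..<n}. seqs_of (n - m))"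
      by (auto simp: seqs_of_def seqs_def)
    then show "(ns, m) \<in> (\<lambda>(m, ns). (ns, m)) ` (SIGMA m:{1..<n}. seqs_of (n - m))"
      by force
  qed
qed (auto simp: split_last_seqs_of_def seqs_of_def seqs_def Suc_le_eq)

theorem theorem2:
  fixes n :: nat
  assumes "n \<ge> 1"
  shows "cm_coproduct (cm_delta n) = cm_delta n \<otimes> 1 + 1 \<otimes> cm_delta n
    + (\<Sum>(ns, m)\<in>split_last_seqs_of n.
        (fact n / ((\<Prod>k\<leftarrow>ns. fact k) * fact m) * cm_alpha ns m) *\<^sub>R
          (prod_list (map cm_delta ns) \<otimes> cm_delta m))"
proof -
  let ?c = "\<lambda>ns m. fact n / ((\<Prod>k\<leftarrow>ns. fact k) * fact m) * cm_alpha ns m"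
  let ?Q = "\<lambda>m. Rep_h1 (H1.psi_coeff m n) \<otimes> cm_delta m"
  obtain k where k: "n = Suc k" using assms by (cases n) auto
  have "cm_coproduct (cm_delta n) = cm_delta n \<otimes> 1 + (\<Sum>m\<le>k. ?Q (Suc m))"
    unfolding k is_cm_coproduct_delta[OF is_cm_coproduct] by (rule cm_dD_eq)
  also have "(\<Sum>m\<le>k. ?Q (Suc m)) = (\<Sum>m=1..n. ?Q m)"
    unfolding k by (rule sum.reindex_bij_witness[where i = "\<lambda>m. m - 1" and j = Suc]) auto
  \<comment> \<open>The diagonal coefficient is 1, so m = n gives the primitive term 1 \<otimes>
    \<delta>_n.\<close>
  also have "\<dots> = (\<Sum>m=1..<n. ?Q m) + 1 \<otimes> cm_delta n"
    using assms by (simp add: sum.last_plus H1.psi_coeff_diag one_h1.rep_eq add.commute)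
  also have "(\<Sum>m=1..<n. ?Q m)
      = (\<Sum>m=1..<n. \<Sum>ns\<in>seqs_of (n - m). ?c ns m *\<^sub>R (prod_list (map cm_delta ns) \<otimes> cm_delta m))"
    by (rule sum.cong)
      (simp_all add: H1.psi_coeff_eq linear_sum[OF linear_Rep_h1] linear_sum[OF linear_tens_left]
        scaleR_h1.rep_eq Rep_h1_prod_list_delta tens_scaleR_left)
  also have "\<dots> = (\<Sum>(ns, m)\<in>split_last_seqs_of n.
      ?c ns m *\<^sub>R (prod_list (map cm_delta ns) \<otimes> cm_delta m))"
    unfolding split_last_seqs_of_eq
    by (subst sum.reindex) (auto simp: inj_on_def sum.Sigma finite_seqs_of split_def)
  finally show ?thesis by (simp add: add_ac)
qed

end
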